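(* Let $\omega\colon\mathbf Z_+\to(0,+\infty)$ be a weight which is bounded from below, such that $\sum_{n\ge0}1/\omega(k2^n)<+\infty$ for every $k\ge3$, and such that $\mathcal T$ is bounded on $\mathcal X_\omega$. Then there exists a Gaussian probability measure $m$ on $\mathcal X_\omega$ with full support which is $\mathcal T$-invariant and such that $\mathcal T$ is ergodic with respect to $m$. In particular this holds for $\omega=\omega_0$, $\omega_0(n)=(n+1)/\pi$.
   Context: $T\colon\mathbf Z_+\to\mathbf Z_+$ is the modified Collatz map: $T(n)=n/2$ for $n$ even, $T(n)=(3n+1)/2$ for $n$ odd. $\mathcal X_\omega$ is the Hilbert space of holomorphic functions $f(z)=\sum_{n\ge3}c_nz^n$ on the unit disk with $\|f\|_\omega^2=\sum_{n\ge3}|c_n|^2/\omega(n)<\infty$. $\mathcal T\sum_{n\ge3}c_nz^n=\sum_{j\ge3,\,T(j)\ge3}c_jz^{T(j)}$. $\mathcal T$ is bounded on $\mathcal X_\omega$ iff the sequences $\omega(6m)/\omega(3m)$, $\omega(6m+2)/\omega(3m+1)$, $(\omega(6m+4)+\omega(2m+1))/\omega(3m+2)$ ($m\ge1$) are bounded; this holds for $\omega_0$. A Borel probability measure $m$ on a complex Hilbert space $H$ is Gaussian if for every $x\in H$ the map $y\mapsto\langle y,x\rangle$ has complex symmetric Gaussian distribution (real and imaginary parts independent centered Gaussians with equal variance); it has full support if $m(U)>0$ for every nonempty open $U$; $\mathcal T$ is $m$-invariant if $m(\mathcal T^{-1}B)=m(B)$ for every Borel $B$, and ergodic if moreover $\mathcal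 T^{-1}B=B$ implies $m(B)\in\{0,1\}$. *)

theory Defs
  imports "HOL-Probability.Probability"
begin

definition collatz :: "nat \<Rightarrow> nat" where
  "collatz n = (if even n then n div 2 else (3 * n + 1) div 2)"

text \<open>Elements of X_omega are identified with their Taylor coefficient sequences
  (c n = 0 for n < 3).\<close>
definition Xw :: "(nat \<Rightarrow> real) \<Rightarrow> (nat \<Rightarrow> complex) set" where
  "Xw \<omega> = {c. (\<forall>n<3. c n = 0) \<and> summable (\<lambda>n. (cmod (c n))\<^sup>2 / \<omega> n)}"

definition normw :: "(nat \<Rightarrow> real) \<Rightarrow> (nat \<Rightarrow> complex) \<Rightarrow> real" where
  "normw \<omega> c = sqrt (\<Sum>n. (cmod (c n))\<^sup>2 / \<omega> n)"

definition innerw :: "(nat \<Rightarrow> real) \<Rightarrow> (nat \<Rightarrow> complex) \<Rightarrow> (nat \<Rightarrow> complex) \<Rightarrow> complex" where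
  "innerw \<omega> y x = (\<Sum>n. y n * cnj (x n) / complex_of_real (\<omega> n))"

definition openw :: "(nat \<Rightarrow> real) \<Rightarrow> (nat \<Rightarrow> complex) set \<Rightarrow> bool" where
  "openw \<omega> U \<longleftrightarrow> U \<subseteq> Xw \<omega> \<and>
     (\<forall>x\<in>U. \<exists>e>0. \<forall>y\<in>Xw \<omega>. normw \<omega> (\<lambda>n. y n - x n) < e \<longrightarrow> y \<in> U)"

definition borelw :: "(nat \<Rightarrow> real) \<Rightarrow> (nat \<Rightarrow> complex) measure" where
  "borelw \<omega> = sigma (Xw \<omega>) {U. openw \<omega> U}"

definition opT :: "(nat \<Rightarrow> complex) \<Rightarrow> (nat \<Rightarrow> complex)" where
  "opT c k = (if 3 \<le> k then (\<Sum>j\<in>{j. 3 \<le> j \<and> collatz j = k}. c j) else 0)"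

definition bounded_on_Xw :: "(nat \<Rightarrow> real) \<Rightarrow> bool" where
  "bounded_on_Xw \<omega> \<longleftrightarrow> (\<forall>c\<in>Xw \<omega>. opT c \<in> Xw \<omega>) \<and>
     (\<exists>C. \<forall>c\<in>Xw \<omega>. normw \<omega> (opT c) \<le> C * normw \<omega> c)"

definition gauss :: "real \<Rightarrow> real measure" where
  "gauss \<sigma> = (if \<sigma> = 0 then return borel 0 else density lborel (normal_density 0 \<sigma>))"

definition complex_sym_gaussian :: "'a measure \<Rightarrow> ('a \<Rightarrow> complex) \<Rightarrow> bool" where
  "complex_sym_gaussian M Z \<longleftrightarrow> Z \<in> borel_measurable M \<and>
     (\<exists>\<sigma>\<ge>0. distr M borel Z = distr (gauss \<sigma> \<Otimes>\<^sub>M gauss \<sigma>) borel (\<lambda>(a, b). Complex a b))"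

definition gaussian_measure_Xw :: "(nat \<Rightarrow> real) \<Rightarrow> (nat \<Rightarrow> complex) measure \<Rightarrow> bool" where
  "gaussian_measure_Xw \<omega> m \<longleftrightarrow> prob_space m \<and> space m = Xw \<omega> \<and> sets m = sets (borelw \<omega>) \<and>
     (\<forall>x\<in>Xw \<omega>. complex_sym_gaussian m (\<lambda>y. innerw \<omega> y x))"

definition full_support_Xw :: "(nat \<Rightarrow> real) \<Rightarrow> (nat \<Rightarrow> complex) measure \<Rightarrow> bool" where
  "full_support_Xw \<omega> m \<longleftrightarrow> (\<forall>U. openw \<omega> U \<and> U \<noteq> {} \<longrightarrow> emeasure m U > 0)"

definition T_invariant :: "(nat \<Rightarrow> complex) measure \<Rightarrow> bool" where
  "T_invariant m \<longleftrightarrow> opT \<in> m \<rightarrow>\<^sub>M m \<and>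
     (\<forall>B\<in>sets m. emeasure m (opT -` B \<inter> space m) = emeasure m B)"

definition T_ergodic :: "(nat \<Rightarrow> complex) measure \<Rightarrow> bool" where
  "T_ergodic m \<longleftrightarrow> T_invariant m \<and>
     (\<forall>B\<in>sets m. opT -` B \<inter> space m = B \<longrightarrow> emeasure m B = 0 \<or> emeasure m B = 1)"

definition omega0 :: "nat \<Rightarrow> real" where
  "omega0 n = (real n + 1) / pi"

end

theory Submission
  imports Defs
begin

text \<open>
  Write \<open>e\<^sub>n\<close> for \<open>z\<^sup>n\<close> if \<open>n \<ge> 3\<close> and \<open>0\<close> otherwise, and let \<open>twin (k 2\<^sup>n) = (3 k + 1) 2\<^sup>n\<close> for odd \<open>k\<close>.
  The vectors \<open>x\<^sub>j = e\<^sub>j - e\<^bsub>twin j\<^esub>\<close> form chains of a backward shift: the operator sends \<open>x\<^bsub>2j\<^esub>\<close>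
  to \<open>x\<^sub>j\<close>, and it kills \<open>x\<^sub>j\<close> for odd \<open>j\<close> because \<open>j\<close> and \<open>3 j + 1\<close> have the same image.
  Hence, for independent standard complex Gaussians \<open>g\<^sub>j\<close> and suitable weights with
  \<open>b\<^bsub>2j\<^esub> = b\<^sub>j > 0\<close>, the random series \<open>V g = \<Sum>\<^sub>j b\<^sub>j g\<^sub>j x\<^sub>j\<close> converges in the space and
  intertwines the operator with the shift \<open>(g\<^sub>j) \<mapsto> (g\<^bsub>2j\<^esub>)\<close>. The law of \<open>V\<close> is therefore invariant,
  and it is ergodic by Kolmogorov's zero-one law. It has full support because the \<open>x\<^sub>j\<close> span a dense
  subspace: averaging the telescoping sums along the orbit of \<open>i\<close> under \<open>twin\<close> approximates \<open>e\<^sub>i\<close>,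
  as the weight is bounded from below.
\<close>

section \<open>Complex Gaussian distributions\<close>

text \<open>Intertwining with the shift forces the weights to be constant along each chain
  \<open>k\<close>, \<open>2 k\<close>, \<open>4 k\<close>, ..., so they cannot be made to decay
  there. Convergence along a chain comes from summability of \<open>1 / \<omega>\<close> along the
  dyadic multiples of both \<open>k\<close> and \<open>3 k + 1\<close>; the weights decay from chain
  to chain. Since \<open>twin j > j\<close>, each coordinate of the series is a finite sum. The
  series and its intertwining relation therefore make sense for every sequence \<open>g\<close>, and
  the norm enters through the almost sure statement that the series lies in the space. The vectors
  of the chains are not orthogonal, but independence and centering make second moments add up, which
  yields both that statement and small tails. A complex coefficient in a linear combination of the
  \<open>g j\<close> rotates the plane, so Gaussianity of all functionals rests on rotation
  invariance of the Gaussian law.\<close>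

lemma measurable_Complex [measurable]:
  "(\<lambda>(a, b). Complex a b) \<in> borel_measurable (borel \<Otimes>\<^sub>M borel)"
proof -
  have "continuous_on UNIV (\<lambda>p::real \<times> real. Complex (fst p) (snd p))"
    unfolding Complex_eq by (intro continuous_intros)
  then have "(\<lambda>p::real \<times> real. Complex (fst p) (snd p)) \<in> borel_measurable borel"
    by (rule borel_measurable_continuous_onI)
  then show ?thesis
    by (simp add: borel_prod case_prod_beta)
qed

lemma borel_measurable_Complex [measurable (raw)]:
  assumes "f \<in> borel_measurable M" "g \<in> borel_measurable M"
  shows "(\<lambda>x. Complex (f x) (g x)) \<in> borel_measurable M"
  using measurable_compose[OF measurable_Pair[OF assms] measurable_Complex] by simp

section \<open>Real and complex centered Gaussian laws expressed through the standard one\<close>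

lemma sets_gauss [simp, measurable_cong]: "sets (gauss \<sigma>) = sets borel"
  by (simp add: gauss_def)

lemma space_gauss [simp]: "space (gauss \<sigma>) = UNIV"
  by (simp add: gauss_def)

lemma prob_space_gauss [simp]: "0 \<le> \<sigma> \<Longrightarrow> prob_space (gauss \<sigma>)"
  by (auto simp: gauss_def intro: prob_space_return prob_space_normal_density)

lemma nn_integral_gauss_1:
  assumes [measurable]: "f \<in> borel_measurable borel"
  shows "(\<integral>\<^sup>+x. f x \<partial>gauss 1) = (\<integral>\<^sup>+x. ennreal (std_normal_density x) * f x \<partial>lborel)"
  by (simp add: gauss_def nn_integral_density)

text \<open>Substitution by \<open>\<sigma> * x\<close>. Reducing everything to
  \<open>gauss 1\<close> turns the degenerate law \<open>gauss 0\<close>, a point mass without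
  density, into an ordinary case from here on.\<close>

lemma nn_integral_gauss:
  assumes [measurable]: "f \<in> borel_measurable borel" and "0 \<le> \<sigma>"
  shows "(\<integral>\<^sup>+x. f x \<partial>gauss \<sigma>) = (\<integral>\<^sup>+x. f (\<sigma> * x) \<partial>gauss 1)"
proof (cases "\<sigma> = 0")
  case True
  interpret prob_space "gauss 1" by simp
  show ?thesis using True emeasure_space_1 by (simp add: gauss_def nn_integral_return)
next
  case False
  then have pos: "\<sigma> > 0" using assms by simp
  have *: "\<sigma> * normal_density 0 \<sigma> (\<sigma> * x) = std_normal_density x" for x
    using pos by (simp add: normal_density_def power_mult_distrib real_sqrt_mult)
  have "(\<integral>\<^sup>+x. f x \<partial>gauss \<sigma>) = (\<integral>\<^sup>+x. ennreal (normal_density 0 \<sigma> x) * f x \<partial>lborel)"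
    using False by (simp add: gauss_def nn_integral_density)
  also have "\<dots> = ennreal \<bar>\<sigma>\<bar> * (\<integral>\<^sup>+x. ennreal (normal_density 0 \<sigma> (0 + \<sigma> * x)) * f (0 + \<sigma> * x) \<partial>lborel)"
    by (rule nn_integral_real_affine) (use False in auto)
  also have "\<dots> = (\<integral>\<^sup>+x. ennreal (std_normal_density x) * f (\<sigma> * x) \<partial>lborel)"
    using pos by (subst nn_integral_cmult[symmetric])
      (auto simp: mult.assoc[symmetric] ennreal_mult'[symmetric] *)
  finally show ?thesis by (simp add: nn_integral_gauss_1)
qed

definition cgauss :: "real \<Rightarrow> complex measure" where
  "cgauss \<sigma> = distr (gauss \<sigma> \<Otimes>\<^sub>M gauss \<sigma>) borel (\<lambda>(a, b). Complex a b)"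

lemma sets_cgauss [simp, measurable_cong]: "sets (cgauss \<sigma>) = sets borel"
  by (simp add: cgauss_def)

lemma space_cgauss [simp]: "space (cgauss \<sigma>) = UNIV"
  by (simp add: cgauss_def)

lemma prob_space_cgauss [simp]: "0 \<le> \<sigma> \<Longrightarrow> prob_space (cgauss \<sigma>)"
  unfolding cgauss_def
  by (intro prob_space.prob_space_distr prob_space_pair) auto

lemma nn_integral_cgauss:
  assumes [measurable]: "f \<in> borel_measurable borel" and "0 \<le> \<sigma>"
  shows "(\<integral>\<^sup>+z. f z \<partial>cgauss \<sigma>) = (\<integral>\<^sup>+x. \<integral>\<^sup>+y. f (Complex (\<sigma> * x) (\<sigma> * y)) \<partial>gauss 1 \<partial>gauss 1)"
proof -
  interpret prob_space "gauss \<sigma>" using assms by simp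
  interpret G: prob_space "gauss 1" by simp
  have "(\<integral>\<^sup>+z. f z \<partial>cgauss \<sigma>) = (\<integral>\<^sup>+x. \<integral>\<^sup>+y. f (Complex x y) \<partial>gauss \<sigma> \<partial>gauss \<sigma>)"
    by (simp add: cgauss_def nn_integral_distr nn_integral_fst[symmetric])
  also have "\<dots> = (\<integral>\<^sup>+x. \<integral>\<^sup>+y. f (Complex x (\<sigma> * y)) \<partial>gauss 1 \<partial>gauss \<sigma>)"
    using assms by (intro nn_integral_cong nn_integral_gauss) auto
  also have "\<dots> = (\<integral>\<^sup>+x. \<integral>\<^sup>+y. f (Complex (\<sigma> * x) (\<sigma> * y)) \<partial>gauss 1 \<partial>gauss 1)"
    using assms by (intro nn_integral_gauss) measurable
  finally show ?thesis .
qed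

text \<open>Recognising a law by its integrals of nonnegative functions turns distribution
  identities into identities of iterated integrals, to which Fubini applies.\<close>

lemma cgauss_eqI:
  assumes "prob_space M" and [measurable]: "Z \<in> borel_measurable M" and "0 \<le> \<sigma>"
    and "\<And>f::complex \<Rightarrow> ennreal. f \<in> borel_measurable borel \<Longrightarrow>
      (\<integral>\<^sup>+x. f (Z x) \<partial>M) = (\<integral>\<^sup>+x. \<integral>\<^sup>+y. f (Complex (\<sigma> * x) (\<sigma> * y)) \<partial>gauss 1 \<partial>gauss 1)"
  shows "distr M borel Z = cgauss \<sigma>"
proof (rule measure_eqI)
  fix A assume "A \<in> sets (distr M borel Z)"
  then have A [measurable]: "A \<in> sets borel" by simp
  have "emeasure (distr M borel Z) A = (\<integral>\<^sup>+z. indicator A z \<partial>distr M borel Z)" by simp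
  also have "\<dots> = (\<integral>\<^sup>+x. indicator A (Z x) \<partial>M)" by (subst nn_integral_distr) auto
  also have "\<dots> = (\<integral>\<^sup>+z. indicator A z \<partial>cgauss \<sigma>)"
    using assms(3,4) by (subst nn_integral_cgauss) auto
  finally show "emeasure (distr M borel Z) A = emeasure (cgauss \<sigma>) A" by simp
qed simp

section \<open>Rotation invariance of Lebesgue and Gaussian measure in the plane\<close>

lemma nn_integral_lborel_shift:
  fixes f :: "real \<Rightarrow> ennreal"
  assumes "f \<in> borel_measurable borel"
  shows "(\<integral>\<^sup>+x. f (x + t) \<partial>lborel) = (\<integral>\<^sup>+x. f x \<partial>lborel)"
  using nn_integral_real_affine[OF assms, of 1 t] by (simp add: add.commute)

lemma nn_integral_lborel_shear:
  fixes F :: "real \<times> real \<Rightarrow> ennreal"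
  assumes [measurable]: "F \<in> borel_measurable borel"
  shows "(\<integral>\<^sup>+x. \<integral>\<^sup>+y. F (x, y + t * x) \<partial>lborel \<partial>lborel) = (\<integral>\<^sup>+x. \<integral>\<^sup>+y. F (x, y) \<partial>lborel \<partial>lborel)"
    and "(\<integral>\<^sup>+x. \<integral>\<^sup>+y. F (x + t * y, y) \<partial>lborel \<partial>lborel) = (\<integral>\<^sup>+x. \<integral>\<^sup>+y. F (x, y) \<partial>lborel \<partial>lborel)"
proof -
  have [measurable]: "F \<in> borel_measurable (borel \<Otimes>\<^sub>M borel)"
    by (simp add: borel_prod)
  show "(\<integral>\<^sup>+x. \<integral>\<^sup>+y. F (x, y + t * x) \<partial>lborel \<partial>lborel) = (\<integral>\<^sup>+x. \<integral>\<^sup>+y. F (x, y) \<partial>lborel \<partial>lborel)"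
    by (intro nn_integral_cong nn_integral_lborel_shift) measurable
  have "(\<integral>\<^sup>+x. \<integral>\<^sup>+y. F (x + t * y, y) \<partial>lborel \<partial>lborel) = (\<integral>\<^sup>+y. \<integral>\<^sup>+x. F (x + t * y, y) \<partial>lborel \<partial>lborel)"
    by (rule lborel_pair.Fubini'[symmetric]) simp
  also have "\<dots> = (\<integral>\<^sup>+y. \<integral>\<^sup>+x. F (x, y) \<partial>lborel \<partial>lborel)"
    by (intro nn_integral_cong nn_integral_lborel_shift) measurable
  also have "\<dots> = (\<integral>\<^sup>+x. \<integral>\<^sup>+y. F (x, y) \<partial>lborel \<partial>lborel)"
    by (rule lborel_pair.Fubini') simp
  finally show "(\<integral>\<^sup>+x. \<integral>\<^sup>+y. F (x + t * y, y) \<partial>lborel \<partial>lborel) = (\<integral>\<^sup>+x. \<integral>\<^sup>+y. F (x, y) \<partial>lborel \<partial>lborel)" .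
qed

text \<open>A rotation with \<open>s \<noteq> 0\<close> is a product of three shears, with slopes \<open>t\<close>, \<open>s\<close>, \<open>t\<close> for
  \<open>t = (c - 1) / s\<close>; each shear preserves Lebesgue measure by Fubini.\<close>
lemma nn_integral_lborel_rotation:
  fixes F :: "real \<times> real \<Rightarrow> ennreal"
  assumes [measurable]: "F \<in> borel_measurable borel" and cs: "c\<^sup>2 + s\<^sup>2 = 1" "s \<noteq> 0"
  shows "(\<integral>\<^sup>+x. \<integral>\<^sup>+y. F (c * x - s * y, s * x + c * y) \<partial>lborel \<partial>lborel) =
    (\<integral>\<^sup>+x. \<integral>\<^sup>+y. F (x, y) \<partial>lborel \<partial>lborel)"
proof -
  define t where "t = (c - 1) / s"
  have [measurable]: "F \<in> borel_measurable (borel \<Otimes>\<^sub>M borel)"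
    by (simp add: borel_prod)
  have ts: "t * s = c - 1" using cs by (simp add: t_def)
  have tc: "t * c + t = - s"
  proof -
    have "t * c + t = (c\<^sup>2 - 1) / s"
      using cs(2) by (simp add: t_def add_divide_distrib[symmetric] algebra_simps power2_eq_square)
    also have "c\<^sup>2 - 1 = - (s * s)" using cs by (simp add: power2_eq_square)
    finally show ?thesis using cs by simp
  qed
  define G where "G = (\<lambda>(x, y). F (x + t * y, y))"
  define H where "H = (\<lambda>(x, y). G (x, y + s * x))"
  have GH [measurable]: "G \<in> borel_measurable borel" "H \<in> borel_measurable borel"
    unfolding H_def G_def borel_prod[symmetric] by measurable
  have "F (c * x - s * y, s * x + c * y) = H (x + t * y, y)" for x y
  proof -
    have "y + s * (x + t * y) = s * x + (1 + t * s) * y" by (simp add: algebra_simps)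
    also have "\<dots> = s * x + c * y" by (simp add: ts)
    finally have 1: "y + s * (x + t * y) = s * x + c * y" .
    have "x + t * y + t * (s * x + c * y) = (1 + t * s) * x + (t * c + t) * y"
      by (simp add: algebra_simps)
    also have "\<dots> = c * x - s * y" by (simp add: ts tc)
    finally show ?thesis by (simp add: H_def G_def 1)
  qed
  then have "(\<integral>\<^sup>+x. \<integral>\<^sup>+y. F (c * x - s * y, s * x + c * y) \<partial>lborel \<partial>lborel) =
      (\<integral>\<^sup>+x. \<integral>\<^sup>+y. H (x + t * y, y) \<partial>lborel \<partial>lborel)" by simp
  also have "\<dots> = (\<integral>\<^sup>+x. \<integral>\<^sup>+y. H (x, y) \<partial>lborel \<partial>lborel)"
    by (rule nn_integral_lborel_shear) measurable
  also have "\<dots> = (\<integral>\<^sup>+x. \<integral>\<^sup>+y. G (x, y) \<partial>lborel \<partial>lborel)"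
    using nn_integral_lborel_shear(1)[OF GH(1), of s] by (simp add: H_def)
  also have "\<dots> = (\<integral>\<^sup>+x. \<integral>\<^sup>+y. F (x, y) \<partial>lborel \<partial>lborel)"
    using nn_integral_lborel_shear(2)[OF assms(1), of t] by (simp add: G_def)
  finally show ?thesis .
qed

text \<open>The density depends on \<open>x^2 + y^2\<close>, which a rotation preserves, so the
  Lebesgue statement applies to the density times \<open>F\<close>.\<close>

lemma nn_integral_gauss_rotation:
  fixes F :: "real \<times> real \<Rightarrow> ennreal"
  assumes F: "F \<in> borel_measurable borel" and cs: "c\<^sup>2 + s\<^sup>2 = 1"
  shows "(\<integral>\<^sup>+x. \<integral>\<^sup>+y. F (c * x - s * y, s * x + c * y) \<partial>gauss 1 \<partial>gauss 1) =
    (\<integral>\<^sup>+x. \<integral>\<^sup>+y. F (x, y) \<partial>gauss 1 \<partial>gauss 1)"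
proof -
  have main: "(\<integral>\<^sup>+x. \<integral>\<^sup>+y. F (c * x - s * y, s * x + c * y) \<partial>gauss 1 \<partial>gauss 1) =
    (\<integral>\<^sup>+x. \<integral>\<^sup>+y. F (x, y) \<partial>gauss 1 \<partial>gauss 1)"
    if F: "F \<in> borel_measurable borel" and cs: "c\<^sup>2 + s\<^sup>2 = 1" "s \<noteq> 0" 
    for F :: "real \<times> real \<Rightarrow> ennreal" and c s
  proof -
    have [measurable]: "F \<in> borel_measurable (borel \<Otimes>\<^sub>M borel)"
      using F by (simp add: borel_prod)
    interpret prob_space "gauss 1" by simp
    let ?d = "\<lambda>x y. ennreal (exp (- (x\<^sup>2 + y\<^sup>2) / 2) / (2 * pi))"
    have dens: "ennreal (std_normal_density x) * ennreal (std_normal_density y) = ?d x y" for x y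
      by (simp add: ennreal_mult'[symmetric] std_normal_density_def mult_exp_exp add_divide_distrib)
    have eq: "(\<integral>\<^sup>+x. \<integral>\<^sup>+y. K (x, y) \<partial>gauss 1 \<partial>gauss 1) = (\<integral>\<^sup>+x. \<integral>\<^sup>+y. ?d x y * K (x, y) \<partial>lborel \<partial>lborel)"
      if [measurable]: "K \<in> borel_measurable (borel \<Otimes>\<^sub>M borel)" for K :: "real \<times> real \<Rightarrow> ennreal"
      by (simp add: nn_integral_gauss_1 nn_integral_cmult[symmetric] mult.assoc[symmetric] dens)
    define K where "K = (\<lambda>(x, y). ?d x y * F (x, y))"
    have K: "K \<in> borel_measurable borel"
      unfolding K_def borel_prod[symmetric] by measurable
    have "(c * x - s * y)\<^sup>2 + (s * x + c * y)\<^sup>2 = (c\<^sup>2 + s\<^sup>2) * (x\<^sup>2 + y\<^sup>2)" for x y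
      by (simp add: algebra_simps power2_eq_square)
    then have sq: "(c * x - s * y)\<^sup>2 + (s * x + c * y)\<^sup>2 = x\<^sup>2 + y\<^sup>2" for x y
      using cs by simp
    have "(\<integral>\<^sup>+x. \<integral>\<^sup>+y. F (c * x - s * y, s * x + c * y) \<partial>gauss 1 \<partial>gauss 1) =
        (\<integral>\<^sup>+x. \<integral>\<^sup>+y. ?d x y * F (c * x - s * y, s * x + c * y) \<partial>lborel \<partial>lborel)"
      using eq[of "\<lambda>(x, y). F (c * x - s * y, s * x + c * y)"] by simp
    also have "\<dots> = (\<integral>\<^sup>+x. \<integral>\<^sup>+y. K (c * x - s * y, s * x + c * y) \<partial>lborel \<partial>lborel)"
      unfolding K_def by (simp only: sq prod.case)
    also have "\<dots> = (\<integral>\<^sup>+x. \<integral>\<^sup>+y. K (x, y) \<partial>lborel \<partial>lborel)"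
      by (rule nn_integral_lborel_rotation[OF K cs])
    also have "\<dots> = (\<integral>\<^sup>+x. \<integral>\<^sup>+y. F (x, y) \<partial>gauss 1 \<partial>gauss 1)"
      by (simp add: K_def eq)
    finally show ?thesis .
  qed
  show ?thesis
  proof (cases "s = 0")
    case False
    then show ?thesis using main[OF F cs] by simp
  next
    case True
    then have "c = 1 \<or> c = - 1" using cs by (simp add: power2_eq_1_iff)
    then show ?thesis
    proof
      assume "c = - 1"
      define K where "K = (\<lambda>(x, y). F (- y, x))"
      have [measurable]: "F \<in> borel_measurable (borel \<Otimes>\<^sub>M borel)"
        using F by (simp add: borel_prod)
      have K: "K \<in> borel_measurable borel"
        unfolding K_def borel_prod[symmetric] by measurable
      show ?thesis
        using main[OF K, of 0 1] main[OF F, of 0 1] \<open>c = - 1\<close> True by (simp add: K_def)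
    qed (use True in simp)
  qed
qed

text \<open>With \<open>r = sqrt (a^2 + b^2)\<close>, the number \<open>a * x + b * y\<close> is
  \<open>r\<close> times the first coordinate of the point rotated with cosine \<open>a / r\<close>
  and sine \<open>- b / r\<close>; the second coordinate integrates out.\<close>

lemma nn_integral_gauss_sum:
  fixes f :: "real \<Rightarrow> ennreal"
  assumes [measurable]: "f \<in> borel_measurable borel"
  shows "(\<integral>\<^sup>+x. \<integral>\<^sup>+y. f (a * x + b * y) \<partial>gauss 1 \<partial>gauss 1) =
    (\<integral>\<^sup>+x. f (sqrt (a\<^sup>2 + b\<^sup>2) * x) \<partial>gauss 1)"
proof -
  interpret prob_space "gauss 1" by simp
  define r where "r = sqrt (a\<^sup>2 + b\<^sup>2)"
  show ?thesis
  proof (cases "r = 0")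
    case True
    then have "a = 0" "b = 0" by (auto simp: r_def sum_power2_eq_zero_iff)
    then show ?thesis using emeasure_space_1 by (simp add: nn_integral_const)
  next
    case False
    have cs: "(a / r)\<^sup>2 + (- b / r)\<^sup>2 = 1"
      using False by (simp add: power_divide add_divide_distrib[symmetric] r_def)
    have m: "(\<lambda>p::real \<times> real. f (r * fst p)) \<in> borel_measurable borel"
      unfolding borel_prod[symmetric] by measurable
    have "(\<integral>\<^sup>+x. \<integral>\<^sup>+y. f (r * (a / r * x - (- b / r) * y)) \<partial>gauss 1 \<partial>gauss 1) =
        (\<integral>\<^sup>+x. \<integral>\<^sup>+y. f (r * x) \<partial>gauss 1 \<partial>gauss 1)"
      using nn_integral_gauss_rotation[OF m cs] by simp
    moreover have "r * (a / r * x - (- b / r) * y) = a * x + b * y" for x y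
      using False by (simp add: field_simps)
    ultimately show ?thesis
      using emeasure_space_1 by (simp add: r_def[symmetric] nn_integral_const)
  qed
qed

section \<open>Complex Gaussians under multiplication and addition; moments and support\<close>

text \<open>Multiplication by \<open>u\<close> is the rotation by its argument together with scaling
  by \<open>cmod u\<close>. Equal variances of the two parts make the rotation invisible.\<close>

lemma distr_cgauss_mult:
  "distr (cgauss 1) borel (\<lambda>z. u * z) = cgauss (cmod u)"
proof (cases "u = 0")
  case True
  interpret prob_space "cgauss 1" by simp
  interpret G: prob_space "gauss 1" by simp
  have "Complex 0 0 = 0" by (simp add: complex_eq_iff)
  then show ?thesis
    unfolding True using emeasure_space_1 G.emeasure_space_1
    by (intro cgauss_eqI) (simp_all add: prob_space_axioms)
next
  case False
  show ?thesis
  proof (rule cgauss_eqI)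
    fix f :: "complex \<Rightarrow> ennreal" assume [measurable]: "f \<in> borel_measurable borel"
    let ?r = "cmod u"
    have cs: "(Re u / ?r)\<^sup>2 + (Im u / ?r)\<^sup>2 = 1"
      using False by (simp add: power_divide add_divide_distrib[symmetric] cmod_power2[symmetric])
    have eq: "u * Complex x y = Complex (?r * (Re u / ?r * x - Im u / ?r * y))
        (?r * (Im u / ?r * x + Re u / ?r * y))" for x y
      using False by (simp add: complex_eq_iff algebra_simps)
    have m: "(\<lambda>p::real \<times> real. f (Complex (?r * fst p) (?r * snd p))) \<in> borel_measurable borel"
      unfolding borel_prod[symmetric] by measurable
    show "(\<integral>\<^sup>+z. f (u * z) \<partial>cgauss 1) =
        (\<integral>\<^sup>+x. \<integral>\<^sup>+y. f (Complex (?r * x) (?r * y)) \<partial>gauss 1 \<partial>gauss 1)"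
      using nn_integral_gauss_rotation[OF m cs] by (simp add: nn_integral_cgauss eq)
  qed auto
qed

lemma distr_cgauss_add:
  assumes "0 \<le> a" "0 \<le> b"
  shows "distr (cgauss a \<Otimes>\<^sub>M cgauss b) borel (\<lambda>(z, w). z + w) = cgauss (sqrt (a\<^sup>2 + b\<^sup>2))"
proof (rule cgauss_eqI)
  interpret A: prob_space "cgauss a" using assms by simp
  interpret B: prob_space "cgauss b" using assms by simp
  interpret G: prob_space "gauss 1" by simp
  interpret GG: pair_prob_space "gauss 1" "gauss 1" ..
  show "prob_space (cgauss a \<Otimes>\<^sub>M cgauss b)" using assms by (intro prob_space_pair) auto
  fix f :: "complex \<Rightarrow> ennreal" assume f [measurable]: "f \<in> borel_measurable borel"
  let ?r = "sqrt (a\<^sup>2 + b\<^sup>2)"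
  have "(\<integral>\<^sup>+p. f (case p of (z, w) \<Rightarrow> z + w) \<partial>(cgauss a \<Otimes>\<^sub>M cgauss b)) =
      (\<integral>\<^sup>+z. \<integral>\<^sup>+w. f (z + w) \<partial>cgauss b \<partial>cgauss a)"
    by (subst B.nn_integral_fst[symmetric]) auto
  also have "\<dots> = (\<integral>\<^sup>+x. \<integral>\<^sup>+y. \<integral>\<^sup>+x'. \<integral>\<^sup>+y'. f (Complex (a * x + b * x') (a * y + b * y'))
      \<partial>gauss 1 \<partial>gauss 1 \<partial>gauss 1 \<partial>gauss 1)"
    using assms by (simp add: nn_integral_cgauss complex_add)
  \<comment> \<open>Swapping the two middle integrals groups the real parts and the imaginary parts,
    so that the one-dimensional addition formula applies to each group.\<close>
  also have "\<dots> = (\<integral>\<^sup>+x. \<integral>\<^sup>+x'. \<integral>\<^sup>+y. \<integral>\<^sup>+y'. f (Complex (a * x + b * x') (a * y + b * y'))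
      \<partial>gauss 1 \<partial>gauss 1 \<partial>gauss 1 \<partial>gauss 1)"
    by (intro nn_integral_cong GG.Fubini') measurable
  also have "\<dots> = (\<integral>\<^sup>+x. \<integral>\<^sup>+x'. \<integral>\<^sup>+y. f (Complex (a * x + b * x') (?r * y))
      \<partial>gauss 1 \<partial>gauss 1 \<partial>gauss 1)"
    by (intro nn_integral_cong nn_integral_gauss_sum[where f="\<lambda>t. f (Complex _ t)"]) measurable
  also have "\<dots> = (\<integral>\<^sup>+x. \<integral>\<^sup>+y. f (Complex (?r * x) (?r * y)) \<partial>gauss 1 \<partial>gauss 1)"
    by (rule nn_integral_gauss_sum) measurable
  finally show "(\<integral>\<^sup>+p. f (case p of (z, w) \<Rightarrow> z + w) \<partial>(cgauss a \<Otimes>\<^sub>M cgauss b)) =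
    (\<integral>\<^sup>+x. \<integral>\<^sup>+y. f (Complex (?r * x) (?r * y)) \<partial>gauss 1 \<partial>gauss 1)" .
qed auto

text \<open>\<open>K\<close> is 2, one unit of variance from each of the real and imaginary parts.
  Later estimates use it as one positive constant valid for all \<open>\<sigma>\<close>.\<close>

lemma nn_integral_cgauss_square:
  obtains K where "0 < K" "\<And>\<sigma>. 0 \<le> \<sigma> \<Longrightarrow> (\<integral>\<^sup>+z. ennreal ((cmod z)\<^sup>2) \<partial>cgauss \<sigma>) = ennreal (\<sigma>\<^sup>2 * K)"
proof
  interpret G: prob_space "gauss 1" by simp
  have 1: "(\<integral>\<^sup>+x. ennreal (x\<^sup>2) \<partial>gauss 1) = 1"
  proof -
    have "has_bochner_integral lborel (\<lambda>x. std_normal_density x * x\<^sup>2) 1"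
      using std_normal_moment_even[of 1] by (simp add: fact_numeral)
    then have "(\<integral>\<^sup>+x. ennreal (std_normal_density x * x\<^sup>2) \<partial>lborel) = ennreal 1"
      by (subst nn_integral_eq_integral) (auto simp: has_bochner_integral_iff)
    then show ?thesis by (simp add: nn_integral_gauss_1 ennreal_mult')
  qed
  fix \<sigma> :: real assume \<sigma>: "0 \<le> \<sigma>"
  have "(\<integral>\<^sup>+z. ennreal ((cmod z)\<^sup>2) \<partial>cgauss \<sigma>) =
      (\<integral>\<^sup>+x. \<integral>\<^sup>+y. ennreal (\<sigma>\<^sup>2) * (ennreal (x\<^sup>2) + ennreal (y\<^sup>2)) \<partial>gauss 1 \<partial>gauss 1)"
    using \<sigma> by (subst nn_integral_cgauss)
      (auto simp: cmod_power2 power_mult_distrib ennreal_mult'[symmetric] ennreal_plus[symmetric] distrib_left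
            simp del: ennreal_plus)
  also have "\<dots> = ennreal (\<sigma>\<^sup>2) * 2"
    by (simp add: nn_integral_cmult nn_integral_add 1 G.emeasure_space_1[simplified])
  finally show "(\<integral>\<^sup>+z. ennreal ((cmod z)\<^sup>2) \<partial>cgauss \<sigma>) = ennreal (\<sigma>\<^sup>2 * 2)"
    by (simp add: ennreal_mult')
qed simp

lemma emeasure_cgauss_ball_pos:
  assumes "0 < e"
  shows "0 < emeasure (cgauss 1) (ball z e)"
proof -
  interpret G: prob_space "gauss 1" by simp
  have pos: "0 < emeasure (gauss 1) {a<..<b}" if "a < b" for a b :: real
  proof (rule ccontr)
    assume "\<not> ?thesis"
    then have "{a<..<b} \<in> null_sets (density lborel std_normal_density)"
      by (auto simp: gauss_def)
    then have "AE x in lborel. x \<in> {a<..<b} \<longrightarrow> ennreal (std_normal_density x) = 0"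
      by (subst (asm) null_sets_density_iff) auto
    then have "AE x in lborel. x \<notin> {a<..<b}"
    proof eventually_elim
      case (elim x)
      have "ennreal (std_normal_density x) \<noteq> 0" using normal_density_pos[of 1 0 x] by simp
      with elim show ?case by blast
    qed
    then have "{a<..<b} \<in> null_sets lborel" by (subst AE_iff_null_sets) auto
    then show False using that by (simp add: null_sets_def)
  qed
  \<comment> \<open>A square of half side \<open>e / 2\<close> fits into the ball because the
    modulus is at most the sum of the absolute values of the two parts.\<close>
  define R where "R = {Re z - e/2<..<Re z + e/2} \<times> {Im z - e/2<..<Im z + e/2}"
  have "(case p of (x, y) \<Rightarrow> Complex x y) \<in> ball z e" if "p \<in> R" for p
  proof -
    obtain x y where p: "p = (x, y)" by (cases p)
    then have xy: "\<bar>x - Re z\<bar> < e/2" "\<bar>y - Im z\<bar> < e/2"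
      using \<open>p \<in> R\<close> unfolding R_def abs_less_iff by auto
    have "cmod (Complex x y - z) \<le> \<bar>x - Re z\<bar> + \<bar>y - Im z\<bar>"
      using cmod_le[of "Complex x y - z"] by simp
    also have "\<dots> < e" using xy by linarith
    finally show ?thesis using p by (simp add: dist_norm norm_minus_commute)
  qed
  then have "R \<subseteq> (\<lambda>(x, y). Complex x y) -` ball z e \<inter> space (gauss 1 \<Otimes>\<^sub>M gauss 1)"
    by (auto simp: space_pair_measure)
  moreover have "(\<lambda>(x, y). Complex x y) -` ball z e \<inter> space (gauss 1 \<Otimes>\<^sub>M gauss 1) \<in> sets (gauss 1 \<Otimes>\<^sub>M gauss 1)"
    by measurable
  ultimately have "emeasure (gauss 1 \<Otimes>\<^sub>M gauss 1) R \<le> emeasure (cgauss 1) (ball z e)"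
    unfolding cgauss_def by (subst emeasure_distr) (auto intro!: emeasure_mono)
  moreover have "0 < emeasure (gauss 1 \<Otimes>\<^sub>M gauss 1) R"
    unfolding R_def using assms pos
    by (subst G.emeasure_pair_measure_Times) (auto simp: zero_less_iff_neq_zero)
  ultimately show ?thesis by order
qed

section \<open>Limits of complex Gaussians\<close>

text \<open>The indicator of an open set is the pointwise limit of bounded continuous functions
  built from the distance to its complement, and the open sets form an intersection-stable
  generator.\<close>

lemma measure_eqI_continuous:
  fixes M N :: "'a::metric_space measure"
  assumes "prob_space M" "prob_space N" and sets: "sets M = sets borel" "sets N = sets borel"
    and eq: "\<And>f::'a \<Rightarrow> real. continuous_on UNIV f \<Longrightarrow> (\<And>x. 0 \<le> f x) \<Longrightarrow> (\<And>x. f x \<le> 1) \<Longrightarrow>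
      (\<integral>x. f x \<partial>M) = (\<integral>x. f x \<partial>N)"
  shows "M = N"
proof (rule measure_eqI_generator_eq)
  interpret M: prob_space M by fact
  interpret N: prob_space N by fact
  have [measurable_cong]: "sets M = sets borel" "sets N = sets borel" by fact+
  have space: "space M = UNIV" "space N = UNIV"
    using sets by (auto dest: sets_eq_imp_space_eq)
  show "Int_stable {S::'a set. open S}" by (auto simp: Int_stable_def)
  show "sets M = sigma_sets UNIV {S. open S}" "sets N = sigma_sets UNIV {S. open S}"
    using sets by (simp_all add: borel_def)
  show "emeasure M ((\<lambda>_::nat. UNIV) i) \<noteq> \<infinity>" for i :: nat by simp
  fix U :: "'a set" assume "U \<in> {S. open S}"
  then have U: "open U" by simp
  show "emeasure M U = emeasure N U"
  \<comment> \<open>The whole space is treated apart: \<open>infdist\<close> to the empty set is 0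
    by convention, so the approximating functions would vanish identically.\<close>
  proof (cases "U = UNIV")
    case True
    then show ?thesis
      using M.emeasure_space_1 N.emeasure_space_1 space by simp
  next
    case False
    define f :: "nat \<Rightarrow> 'a \<Rightarrow> real" where "f n x = min 1 (real n * infdist x (- U))" for n x
    have cont: "continuous_on UNIV (f n)" for n
      unfolding f_def by (intro continuous_intros)
    have [measurable]: "f n \<in> borel_measurable borel" for n
      by (rule borel_measurable_continuous_onI[OF cont])
    have [measurable]: "U \<in> sets borel" using U by simp
    have f01: "0 \<le> f n x" "f n x \<le> 1" for n x
      by (auto simp: f_def infdist_nonneg)
    have lim: "(\<lambda>n. f n x) \<longlonglongrightarrow> indicator U x" for x
    proof (cases "x \<in> U")
      case True
      then have "infdist x (- U) \<noteq> 0"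
        using U False in_closed_iff_infdist_zero[of "- U" x] by auto
      then have d: "infdist x (- U) > 0" by (simp add: infdist_nonneg order_less_le)
      have "eventually (\<lambda>n. 1 / infdist x (- U) \<le> real n) sequentially"
        using filterlim_real_sequentially by (simp add: filterlim_at_top)
      then have "eventually (\<lambda>n. 1 \<le> real n * infdist x (- U)) sequentially"
        by eventually_elim (use d in \<open>simp add: pos_divide_le_eq\<close>)
      then have "eventually (\<lambda>n. f n x = indicator U x) sequentially"
        by eventually_elim (use True in \<open>simp add: f_def\<close>)
      then show ?thesis by (rule tendsto_eventually)
    qed (simp add: f_def)
    have "(\<lambda>n. \<integral>x. f n x \<partial>M) \<longlonglongrightarrow> (\<integral>x. indicator U x \<partial>M)"
      using f01 lim by (intro integral_dominated_convergence[where w="\<lambda>_. 1"]) auto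
    moreover have "(\<lambda>n. \<integral>x. f n x \<partial>N) \<longlonglongrightarrow> (\<integral>x. indicator U x \<partial>N)"
      using f01 lim by (intro integral_dominated_convergence[where w="\<lambda>_. 1"]) auto
    ultimately have "(\<integral>x. indicator U x \<partial>M) = (\<integral>x. indicator U x \<partial>N :: real)"
      using eq[OF cont f01] LIMSEQ_unique by simp
    then show ?thesis
      by (simp add: M.emeasure_eq_measure N.emeasure_eq_measure space)
  qed
qed auto

text \<open>Compactness supplies a limit \<open>s\<close> for a subsequence of the deviations.
  Writing \<open>cgauss a\<close> as the law of \<open>a * z\<close> under \<open>cgauss 1\<close>
  turns convergence of deviations into dominated convergence for one fixed measure.\<close>

lemma cgauss_limit:
  assumes "prob_space M" and Z [measurable]: "\<And>n. Z n \<in> borel_measurable M" "Z' \<in> borel_measurable M"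
    and distr: "\<And>n. distr M borel (Z n) = cgauss (\<sigma> n)"
    and \<sigma>: "\<And>n. 0 \<le> \<sigma> n" "\<And>n. \<sigma> n \<le> C"
    and lim: "AE x in M. (\<lambda>n. Z n x) \<longlonglongrightarrow> Z' x"
  obtains s where "0 \<le> s" "distr M borel Z' = cgauss s"
proof -
  interpret M: prob_space M by fact
  interpret C: prob_space "cgauss 1" by simp
  have "\<forall>n. \<sigma> n \<in> {0..C}" using \<sigma> by auto
  then obtain s r where s: "s \<in> {0..C}" "strict_mono r" "(\<sigma> \<circ> r) \<longlonglongrightarrow> s"
    using compact_Icc[of 0 C] unfolding compact_def by blast
  have "distr M borel Z' = cgauss s"
  proof (rule measure_eqI_continuous)
    fix f :: "complex \<Rightarrow> real"
    assume f: "continuous_on UNIV f" "\<And>x. 0 \<le> f x" "\<And>x. f x \<le> 1"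
    have [measurable]: "f \<in> borel_measurable borel"
      by (rule borel_measurable_continuous_onI[OF f(1)])
    have isCont: "isCont f x" for x using f(1) by (simp add: continuous_on_eq_continuous_at)
    have cg: "(\<integral>z. f z \<partial>cgauss a) = (\<integral>z. f (of_real a * z) \<partial>cgauss 1)" if "0 \<le> a" for a
    proof -
      have "cgauss a = distr (cgauss 1) borel (\<lambda>z. of_real a * z)"
        using that by (simp add: distr_cgauss_mult)
      then show ?thesis by (simp add: integral_distr)
    qed
    have "(\<lambda>n. \<integral>x. f (Z (r n) x) \<partial>M) \<longlonglongrightarrow> (\<integral>x. f (Z' x) \<partial>M)"
    proof (rule integral_dominated_convergence[where w="\<lambda>_. 1"])
      show "AE x in M. (\<lambda>n. f (Z (r n) x)) \<longlonglongrightarrow> f (Z' x)"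
        using lim
      proof eventually_elim
        case (elim x)
        then have "((\<lambda>n. Z n x) \<circ> r) \<longlonglongrightarrow> Z' x" using s(2) by (rule LIMSEQ_subseq_LIMSEQ)
        then show ?case using isCont_tendsto_compose[OF isCont] by (simp add: o_def)
      qed
    qed (use f in auto)
    moreover have "(\<integral>x. f (Z (r n) x) \<partial>M) = (\<integral>z. f (of_real (\<sigma> (r n)) * z) \<partial>cgauss 1)" for n
    proof -
      have "(\<integral>x. f (Z (r n) x) \<partial>M) = (\<integral>z. f z \<partial>distr M borel (Z (r n)))"
        by (simp add: integral_distr)
      then show ?thesis using distr cg[OF \<sigma>(1)] by simp
    qed
    moreover have "(\<lambda>n. \<integral>z. f (of_real (\<sigma> (r n)) * z) \<partial>cgauss 1) \<longlonglongrightarrow> (\<integral>z. f (of_real s * z) \<partial>cgauss 1)"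
    proof (rule integral_dominated_convergence[where w="\<lambda>_. 1"])
      have "(\<lambda>n. f (of_real (\<sigma> (r n)) * z)) \<longlonglongrightarrow> f (of_real s * z)" for z
        using s(3) by (intro isCont_tendsto_compose[OF isCont] tendsto_intros) (simp add: o_def)
      then show "AE z in cgauss 1. (\<lambda>n. f (of_real (\<sigma> (r n)) * z)) \<longlonglongrightarrow> f (of_real s * z)" by simp
    qed (use f in auto)
    ultimately have "(\<integral>x. f (Z' x) \<partial>M) = (\<integral>z. f (of_real s * z) \<partial>cgauss 1)"
      using LIMSEQ_unique by simp
    then show "(\<integral>x. f x \<partial>distr M borel Z') = (\<integral>x. f x \<partial>cgauss s)"
      using s(1) by (simp add: integral_distr cg)
  qed (use s(1) in \<open>auto intro: M.prob_space_distr\<close>)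
  then show ?thesis using that s(1) by auto
qed

section \<open>The sequence of independent standard complex Gaussians\<close>

definition noise :: "(nat \<Rightarrow> complex) measure" where
  "noise = (\<Pi>\<^sub>M i\<in>UNIV. cgauss 1)"

lemma sets_noise [measurable_cong]: "sets noise = sets (\<Pi>\<^sub>M i\<in>UNIV. borel)"
  unfolding noise_def by (intro sets_PiM_cong) auto

lemma space_noise [simp]: "space noise = UNIV"
  by (simp add: noise_def space_PiM)

interpretation noise: prob_space noise
  unfolding noise_def by (intro prob_space_PiM) simp

lemma distr_noise_component: "distr noise borel (\<lambda>g. g i) = cgauss 1"
proof -
  have "distr noise (cgauss 1) (\<lambda>g. g i) = cgauss 1"
    unfolding noise_def by (rule distr_PiM_component) auto
  moreover have "distr noise borel (\<lambda>g. g i) = distr noise (cgauss 1) (\<lambda>g. g i)"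
    by (rule distr_cong) auto
  ultimately show ?thesis by simp
qed

lemma indep_vars_noise: "noise.indep_vars (\<lambda>_. borel) (\<lambda>i g. g i) UNIV"
proof (subst noise.indep_vars_iff_distr_eq_PiM)
  show "distr noise (\<Pi>\<^sub>M i\<in>UNIV. borel) (\<lambda>x. \<lambda>i\<in>UNIV. x i) =
      (\<Pi>\<^sub>M i\<in>UNIV. distr noise borel (\<lambda>g. g i))"
    unfolding distr_noise_component noise_def[symmetric]
    using distr_id2[OF sets_noise[symmetric]] by (simp add: restrict_def)
qed auto

text \<open>Induction on \<open>J\<close>: the new summand reads a coordinate outside the earlier
  ones, hence is independent of the partial sum, and squared deviations of independent complex
  Gaussians add.\<close>

lemma distr_noise_sum:
  assumes "finite J"
  shows "distr noise borel (\<lambda>g. \<Sum>j\<in>J. c j * g j) = cgauss (sqrt (\<Sum>j\<in>J. (cmod (c j))\<^sup>2))"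
  using assms
proof induction
  case empty
  interpret C: prob_space "cgauss 1" by simp
  have "distr (cgauss 1) borel (\<lambda>z. 0) = cgauss 0"
    using distr_cgauss_mult[of 0] by simp
  then show ?case by (simp add: noise.distr_const C.distr_const)
next
  case (insert i J)
  have "noise.indep_var
    borel ((\<lambda>f. \<Sum>j\<in>J. c j * f j) \<circ> (\<lambda>g. restrict (\<lambda>j. g j) J))
    borel ((\<lambda>f. c i * f i) \<circ> (\<lambda>g. restrict (\<lambda>j. g j) {i}))"
    using insert by (intro noise.indep_var_compose[OF noise.indep_var_restrict[OF indep_vars_noise]]) auto
  moreover have "((\<lambda>f. \<Sum>j\<in>J. c j * f j) \<circ> (\<lambda>g. restrict (\<lambda>j. g j) J)) = (\<lambda>g. \<Sum>j\<in>J. c j * g j)"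
    by (auto intro!: sum.cong)
  moreover have "((\<lambda>f. c i * f i) \<circ> (\<lambda>g. restrict (\<lambda>j. g j) {i})) = (\<lambda>g. c i * g i)"
    by auto
  ultimately have ind: "noise.indep_var borel (\<lambda>g. \<Sum>j\<in>J. c j * g j) borel (\<lambda>g. c i * g i)" 
    by simp
  have "distr noise borel (\<lambda>g. c i * g i) = distr (distr noise borel (\<lambda>g. g i)) borel (\<lambda>z. c i * z)"
    by (subst distr_distr) (auto simp: o_def)
  also have "\<dots> = cgauss (cmod (c i))"
    by (simp add: distr_noise_component distr_cgauss_mult)
  finally have 1: "distr noise borel (\<lambda>g. c i * g i) = cgauss (cmod (c i))" .
  have "distr noise borel (\<lambda>g. \<Sum>j\<in>insert i J. c j * g j) =
      distr (distr noise (borel \<Otimes>\<^sub>M borel) (\<lambda>g. (\<Sum>j\<in>J. c j * g j, c i * g i))) borel (\<lambda>(z, w). z + w)"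
    using insert by (subst distr_distr) (auto simp: o_def add.commute)
  also have "distr noise (borel \<Otimes>\<^sub>M borel) (\<lambda>g. (\<Sum>j\<in>J. c j * g j, c i * g i)) =
      cgauss (sqrt (\<Sum>j\<in>J. (cmod (c j))\<^sup>2)) \<Otimes>\<^sub>M cgauss (cmod (c i))"
    using ind unfolding noise.indep_var_distribution_eq insert.IH 1 by simp
  also have "distr \<dots> borel (\<lambda>(z, w). z + w) = cgauss (sqrt (\<Sum>j\<in>insert i J. (cmod (c j))\<^sup>2))"
    using insert by (subst distr_cgauss_add) (auto simp: sum_nonneg add.commute)
  finally show ?case .
qed

lemma noise_head_pos:
  assumes "0 < \<delta>"
  shows "0 < emeasure noise {g. \<forall>j<M. cmod (g j - z j) < \<delta>}"
proof -
  have "prod_emb UNIV (\<lambda>_. cgauss 1) {..<M} (\<Pi>\<^sub>E j\<in>{..<M}. ball (z j) \<delta>) = {g. \<forall>j<M. cmod (g j - z j) < \<delta>}"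
  proof -
    have "w \<in> ball (z j) \<delta> \<longleftrightarrow> cmod (w - z j) < \<delta>" for w j
      by (simp only: mem_ball dist_norm norm_minus_commute[of "z j"])
    then have "restrict g {..<M} \<in> (\<Pi>\<^sub>E j\<in>{..<M}. ball (z j) \<delta>) \<longleftrightarrow> (\<forall>j<M. cmod (g j - z j) < \<delta>)" for g
      by (simp only: restrict_PiE_iff lessThan_iff Ball_def)
    then show ?thesis by (simp add: prod_emb_def vimage_def)
  qed
  then have "emeasure noise {g. \<forall>j<M. cmod (g j - z j) < \<delta>} = (\<Prod>j\<in>{..<M}. emeasure (cgauss 1) (ball (z j) \<delta>))"
    using emeasure_PiM_emb[of UNIV "\<lambda>_. cgauss 1" "{..<M}" "\<lambda>j. ball (z j) \<delta>"]
    by (simp add: noise_def)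
  moreover have "(\<Prod>j\<in>{..<M}. emeasure (cgauss 1) (ball (z j) \<delta>)) \<noteq> 0"
    using emeasure_cgauss_ball_pos[OF assms] by (auto simp: prod_zero_iff zero_less_iff_neq_zero)
  ultimately show ?thesis by (simp add: zero_less_iff_neq_zero)
qed

text \<open>Head and tail are read from disjoint blocks of independent coordinates, so the two
  probabilities multiply. This permits prescribing the first entries approximately while the rest of
  the series stays small.\<close>

lemma noise_head_tail_pos:
  assumes H: "{f \<in> space (\<Pi>\<^sub>M i\<in>{..<M}. borel). P f} \<in> sets (\<Pi>\<^sub>M i\<in>{..<M}. borel)"
    and T: "{f \<in> space (\<Pi>\<^sub>M i\<in>{M..}. borel). Q f} \<in> sets (\<Pi>\<^sub>M i\<in>{M..}. borel)"
    and P: "0 < emeasure noise {g. P (restrict g {..<M})}"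
    and Q: "0 < emeasure noise {g. Q (restrict g {M..})}"
  shows "0 < emeasure noise {g. P (restrict g {..<M}) \<and> Q (restrict g {M..})}"
proof -
  let ?A = "{f \<in> space (\<Pi>\<^sub>M i\<in>{..<M}. borel). P f}" and ?B = "{f \<in> space (\<Pi>\<^sub>M i\<in>{M..}. borel). Q f}"
  have "noise.indep_var (\<Pi>\<^sub>M i\<in>{..<M}. borel) (\<lambda>g. restrict g {..<M}) (\<Pi>\<^sub>M i\<in>{M..}. borel) (\<lambda>g. restrict g {M..})"
    by (rule noise.indep_var_restrict[OF indep_vars_noise]) auto
  from noise.indep_varD[OF this H T]
  have "noise.prob {g. P (restrict g {..<M}) \<and> Q (restrict g {M..})} =
      noise.prob {g. P (restrict g {..<M})} * noise.prob {g. Q (restrict g {M..})}"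
    by (simp add: vimage_def space_PiM)
  moreover have "0 < noise.prob {g. P (restrict g {..<M})}" "0 < noise.prob {g. Q (restrict g {M..})}"
    using P Q by (simp_all add: noise.emeasure_eq_measure)
  ultimately have "0 < noise.prob {g. P (restrict g {..<M}) \<and> Q (restrict g {M..})}" by simp
  then show "0 < emeasure noise {g. P (restrict g {..<M}) \<and> Q (restrict g {M..})}"
    by (simp add: noise.emeasure_eq_measure)
qed

text \<open>Reindexing a product of identical factors along an injective map reproduces the product.
  This is the measure-preserving shift behind invariance.\<close>

lemma distr_noise_shift: "distr noise noise (\<lambda>g j. g (2 * j)) = noise"
  using distr_PiM_reindex[of UNIV "\<lambda>_. cgauss 1" "\<lambda>n::nat. 2 * n" UNIV]
  by (simp add: noise_def restrict_def inj_on_def)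

section \<open>The weighted sequence space and its Borel sets\<close>

text \<open>The squared norm is a plain series, which suits expectations and measurability. In place
  of the triangle inequality it obeys a bound with a factor 2 on each summand, hence the quarters in
  the error budgets below.\<close>

definition nrm2 :: "(nat \<Rightarrow> real) \<Rightarrow> (nat \<Rightarrow> complex) \<Rightarrow> real" where
  "nrm2 \<omega> c = (\<Sum>n. (cmod (c n))\<^sup>2 / \<omega> n)"

lemma cmod_add_square_le: "(cmod (a + b))\<^sup>2 \<le> 2 * (cmod a)\<^sup>2 + 2 * (cmod b)\<^sup>2"
proof -
  have "(cmod (a + b))\<^sup>2 \<le> (cmod a + cmod b)\<^sup>2"
    by (intro power_mono norm_triangle_ineq) auto
  also have "\<dots> \<le> 2 * (cmod a)\<^sup>2 + 2 * (cmod b)\<^sup>2"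
    using zero_le_power2[of "cmod a - cmod b"] by (simp add: power2_eq_square algebra_simps)
  finally show ?thesis .
qed

lemma nrm2_less_iff: "0 < e \<Longrightarrow> normw \<omega> c < e \<longleftrightarrow> nrm2 \<omega> c < e\<^sup>2"
  unfolding normw_def nrm2_def[symmetric]
  by (metis abs_of_pos real_sqrt_abs real_sqrt_less_iff)

lemma Xw_zero: "c \<in> Xw \<omega> \<Longrightarrow> n < 3 \<Longrightarrow> c n = 0"
  by (simp add: Xw_def)

lemma summable_truncate:
  assumes "summable f" "\<And>j. 0 \<le> f j"
  shows "summable (\<lambda>j. if M \<le> j then f j else 0 :: real)"
  by (rule summable_comparison_test'[OF assms(1), of 0]) (simp add: assms(2))

lemma suminf_truncate_tendsto_0:
  assumes f: "summable f" "\<And>j. 0 \<le> f j"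
  shows "(\<lambda>M. \<Sum>j. if M \<le> j then f j else 0 :: real) \<longlonglongrightarrow> 0"
proof -
  have "(\<Sum>j. if M \<le> j then f j else 0) = suminf f - (\<Sum>j<M. f j)" for M
  proof -
    have "suminf (\<lambda>j. if M \<le> j then f j else 0) =
        (\<Sum>j. if M \<le> j + M then f (j + M) else 0) + (\<Sum>j<M. if M \<le> j then f j else 0)"
      by (rule suminf_split_initial_segment[OF summable_truncate[OF f]])
    then show ?thesis using suminf_minus_initial_segment[OF f(1), of M] by simp
  qed
  moreover have "(\<lambda>M. suminf f - (\<Sum>j<M. f j)) \<longlonglongrightarrow> suminf f - suminf f"
    by (intro tendsto_intros summable_LIMSEQ f(1))
  ultimately show ?thesis by simp
qed

text \<open>The value \<open>\<omega> 0\<close> is arbitrary, so nonnegativity of the terms of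
  \<open>nrm2\<close> relies on the coordinates vanishing below 3.\<close>

locale weight =
  fixes \<omega> :: "nat \<Rightarrow> real"
  assumes pos: "1 \<le> n \<Longrightarrow> 0 < \<omega> n"
begin

lemma term_nonneg: "(\<And>n. n < 3 \<Longrightarrow> c n = 0) \<Longrightarrow> 0 \<le> (cmod (c n))\<^sup>2 / \<omega> n"
  using pos[of n] by (cases "n < 3") (auto intro: divide_nonneg_pos)

lemma Xw_term_nonneg: "c \<in> Xw \<omega> \<Longrightarrow> 0 \<le> (cmod (c n))\<^sup>2 / \<omega> n"
  by (rule term_nonneg) (rule Xw_zero)

lemma nrm2_nonneg: "c \<in> Xw \<omega> \<Longrightarrow> 0 \<le> nrm2 \<omega> c"
  unfolding nrm2_def by (intro suminf_nonneg) (auto simp: Xw_def Xw_term_nonneg)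

lemma term_le_nrm2: "c \<in> Xw \<omega> \<Longrightarrow> (cmod (c n))\<^sup>2 / \<omega> n \<le> nrm2 \<omega> c"
  unfolding nrm2_def using Xw_term_nonneg[of c] sum_le_suminf[of "\<lambda>n. (cmod (c n))\<^sup>2 / \<omega> n" "{n}"]
  by (simp add: Xw_def)

lemma sum_le_nrm2: "c \<in> Xw \<omega> \<Longrightarrow> (\<Sum>n<N. (cmod (c n))\<^sup>2 / \<omega> n) \<le> nrm2 \<omega> c"
  unfolding nrm2_def using Xw_term_nonneg[of c] by (intro sum_le_suminf) (auto simp: Xw_def)

lemma Xw_I:
  assumes "\<And>n. n < 3 \<Longrightarrow> c n = 0" "\<And>N. (\<Sum>n<N. (cmod (c n))\<^sup>2 / \<omega> n) \<le> B"
  shows "c \<in> Xw \<omega>" "nrm2 \<omega> c \<le> B"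
proof -
  have "summable (\<lambda>n. (cmod (c n))\<^sup>2 / \<omega> n)"
    by (intro bounded_imp_summable[of _ B] term_nonneg assms(1))
      (simp_all only: lessThan_Suc_atMost[symmetric] assms(2))
  then show "c \<in> Xw \<omega>" "nrm2 \<omega> c \<le> B"
    using assms by (auto simp: Xw_def nrm2_def intro: suminf_le_const)
qed

lemma Xw_add:
  assumes "a \<in> Xw \<omega>" "b \<in> Xw \<omega>"
  shows "(\<lambda>n. a n + b n) \<in> Xw \<omega>" "nrm2 \<omega> (\<lambda>n. a n + b n) \<le> 2 * nrm2 \<omega> a + 2 * nrm2 \<omega> b"
proof -
  have *: "(\<Sum>n<N. (cmod (a n + b n))\<^sup>2 / \<omega> n) \<le> 2 * nrm2 \<omega> a + 2 * nrm2 \<omega> b" for N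
  proof -
    have "(cmod (a n + b n))\<^sup>2 / \<omega> n \<le> 2 * ((cmod (a n))\<^sup>2 / \<omega> n) + 2 * ((cmod (b n))\<^sup>2 / \<omega> n)" for n
    proof (cases "n < 3")
      case True then show ?thesis by (simp add: Xw_zero[OF assms(1)] Xw_zero[OF assms(2)])
    next
      case False
      then have "(cmod (a n + b n))\<^sup>2 / \<omega> n \<le> (2 * (cmod (a n))\<^sup>2 + 2 * (cmod (b n))\<^sup>2) / \<omega> n"
        using pos[of n] by (intro divide_right_mono cmod_add_square_le) auto
      then show ?thesis by (simp add: add_divide_distrib)
    qed
    then have "(\<Sum>n<N. (cmod (a n + b n))\<^sup>2 / \<omega> n) \<le>
        2 * (\<Sum>n<N. (cmod (a n))\<^sup>2 / \<omega> n) + 2 * (\<Sum>n<N. (cmod (b n))\<^sup>2 / \<omega> n)"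
      unfolding sum_distrib_left sum.distrib[symmetric] by (intro sum_mono)
    then show ?thesis using sum_le_nrm2[OF assms(1), of N] sum_le_nrm2[OF assms(2), of N] by linarith
  qed
  show "(\<lambda>n. a n + b n) \<in> Xw \<omega>" "nrm2 \<omega> (\<lambda>n. a n + b n) \<le> 2 * nrm2 \<omega> a + 2 * nrm2 \<omega> b"
    by (rule Xw_I[OF _ *]; simp add: Xw_zero[OF assms(1)] Xw_zero[OF assms(2)])+
qed

lemma Xw_scale:
  assumes "a \<in> Xw \<omega>"
  shows "(\<lambda>n. t * a n) \<in> Xw \<omega>" "nrm2 \<omega> (\<lambda>n. t * a n) = (cmod t)\<^sup>2 * nrm2 \<omega> a"
proof -
  have "(\<lambda>n. (cmod (a n))\<^sup>2 / \<omega> n) sums nrm2 \<omega> a"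
    using assms unfolding Xw_def nrm2_def by (simp add: summable_sums)
  then have "(\<lambda>n. (cmod t)\<^sup>2 * ((cmod (a n))\<^sup>2 / \<omega> n)) sums ((cmod t)\<^sup>2 * nrm2 \<omega> a)"
    by (rule sums_mult)
  then have *: "(\<lambda>n. (cmod (t * a n))\<^sup>2 / \<omega> n) sums ((cmod t)\<^sup>2 * nrm2 \<omega> a)"
    by (simp add: norm_mult power_mult_distrib)
  show "nrm2 \<omega> (\<lambda>n. t * a n) = (cmod t)\<^sup>2 * nrm2 \<omega> a"
    unfolding nrm2_def[of \<omega> "\<lambda>n. t * a n"] by (rule sums_unique[OF *, symmetric])
  show "(\<lambda>n. t * a n) \<in> Xw \<omega>"
    using assms sums_summable[OF *] by (simp add: Xw_def)
qed

lemma Xw_diff: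
  assumes "a \<in> Xw \<omega>" "b \<in> Xw \<omega>"
  shows "(\<lambda>n. a n - b n) \<in> Xw \<omega>" "nrm2 \<omega> (\<lambda>n. a n - b n) \<le> 2 * nrm2 \<omega> a + 2 * nrm2 \<omega> b"
  using Xw_add[OF assms(1) Xw_scale(1)[OF assms(2), of "-1"]] Xw_scale(2)[OF assms(2), of "-1"] by auto

lemma nrm2_triangle:
  assumes "a \<in> Xw \<omega>" "b \<in> Xw \<omega>" "c \<in> Xw \<omega>"
  shows "nrm2 \<omega> (\<lambda>n. a n - c n) \<le> 2 * nrm2 \<omega> (\<lambda>n. a n - b n) + 2 * nrm2 \<omega> (\<lambda>n. b n - c n)"
  using Xw_add(2)[OF Xw_diff(1)[OF assms(1,2)] Xw_diff(1)[OF assms(2,3)]] by simp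

lemma nrm2_commute: "nrm2 \<omega> (\<lambda>n. a n - b n) = nrm2 \<omega> (\<lambda>n. b n - a n)"
  by (simp add: nrm2_def norm_minus_commute)

lemma Xw_finite:
  assumes "\<And>n. n < 3 \<Longrightarrow> c n = 0" "\<And>n. N \<le> n \<Longrightarrow> c n = 0"
  shows "c \<in> Xw \<omega>" "nrm2 \<omega> c = (\<Sum>n<N. (cmod (c n))\<^sup>2 / \<omega> n)"
proof -
  have "(\<lambda>n. (cmod (c n))\<^sup>2 / \<omega> n) sums (\<Sum>n<N. (cmod (c n))\<^sup>2 / \<omega> n)"
    using assms by (intro sums_finite) auto
  then show "c \<in> Xw \<omega>" "nrm2 \<omega> c = (\<Sum>n<N. (cmod (c n))\<^sup>2 / \<omega> n)"
    using assms by (auto simp: Xw_def nrm2_def sums_iff)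
qed

lemma zero_in_Xw: "(\<lambda>_. 0) \<in> Xw \<omega>"
  by (simp add: Xw_def)

lemma Xw_truncate:
  assumes "x \<in> Xw \<omega>" "0 < e"
  obtains N where "nrm2 \<omega> (\<lambda>n. x n - (if n < N then x n else 0)) < e"
proof -
  have sm: "summable (\<lambda>n. (cmod (x n))\<^sup>2 / \<omega> n)" using assms by (simp add: Xw_def)
  then have "(\<lambda>N. \<Sum>n<N. (cmod (x n))\<^sup>2 / \<omega> n) \<longlonglongrightarrow> nrm2 \<omega> x"
    unfolding nrm2_def by (rule summable_LIMSEQ)
  then obtain N where N: "\<bar>(\<Sum>n<N. (cmod (x n))\<^sup>2 / \<omega> n) - nrm2 \<omega> x\<bar> < e"
    using assms(2) LIMSEQ_D[of _ "nrm2 \<omega> x" e] by (auto simp: real_norm_def)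
  define y where "y n = (if n < N then x n else 0)" for n
  have "y \<in> Xw \<omega>" "nrm2 \<omega> y = (\<Sum>n<N. (cmod (y n))\<^sup>2 / \<omega> n)"
    by (rule Xw_finite[where N=N]; simp add: y_def Xw_zero[OF assms(1)])+
  then have y: "y \<in> Xw \<omega>" "nrm2 \<omega> y = (\<Sum>n<N. (cmod (x n))\<^sup>2 / \<omega> n)"
    by (auto simp: y_def)
  \<comment> \<open>Truncation is an orthogonal projection, so squared norms subtract; termwise, one
    of the two contributions vanishes.\<close>
  have "nrm2 \<omega> x - nrm2 \<omega> y = (\<Sum>n. (cmod (x n))\<^sup>2 / \<omega> n - (cmod (y n))\<^sup>2 / \<omega> n)"
    unfolding nrm2_def using sm y(1) by (intro suminf_diff) (auto simp: Xw_def)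
  also have "\<dots> = nrm2 \<omega> (\<lambda>n. x n - y n)"
    unfolding nrm2_def by (intro suminf_cong) (auto simp: y_def)
  finally show thesis using that[of N] N y(2) by (simp add: y_def)
qed

lemma inner_summable:
  assumes y: "y \<in> Xw \<omega>" and x: "x \<in> Xw \<omega>"
  shows "summable (\<lambda>n. y n * (cnj (x n) / complex_of_real (\<omega> n)))"
proof (rule summable_comparison_test')
  show "summable (\<lambda>n. (cmod (y n))\<^sup>2 / \<omega> n + (cmod (x n))\<^sup>2 / \<omega> n)"
    using x y by (intro summable_add) (auto simp: Xw_def)
  fix n :: nat assume "0 \<le> n"
  show "norm (y n * (cnj (x n) / complex_of_real (\<omega> n))) \<le> (cmod (y n))\<^sup>2 / \<omega> n + (cmod (x n))\<^sup>2 / \<omega> n"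
  proof (cases "n < 3")
    case False
    then have w: "0 < \<omega> n" using pos[of n] by simp
    have "0 \<le> (cmod (y n) - cmod (x n))\<^sup>2 + (cmod (y n))\<^sup>2 + (cmod (x n))\<^sup>2" by simp
    then have "cmod (y n) * cmod (x n) \<le> (cmod (y n))\<^sup>2 + (cmod (x n))\<^sup>2"
      unfolding power2_diff by linarith
    then have "cmod (y n) * cmod (x n) / \<omega> n \<le> ((cmod (y n))\<^sup>2 + (cmod (x n))\<^sup>2) / \<omega> n"
      using w by (intro divide_right_mono) auto
    then show ?thesis using w by (simp add: norm_mult norm_divide add_divide_distrib)
  qed (simp add: Xw_zero[OF x] Xw_zero[OF y])
qed

section \<open>Separability, and norm-Borel sets versus the product sigma-algebra\<close>

lemma nrm2_measurable [measurable]: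
  assumes [measurable]: "\<And>n. (\<lambda>x. f x n) \<in> borel_measurable M"
  shows "(\<lambda>x. nrm2 \<omega> (f x)) \<in> borel_measurable M"
  unfolding nrm2_def by measurable

lemma Xw_measurable [measurable]: "Xw \<omega> \<in> sets (\<Pi>\<^sub>M i\<in>UNIV. borel)"
proof -
  have "Xw \<omega> = {c \<in> space (\<Pi>\<^sub>M i\<in>UNIV. borel). \<forall>n<3. c n = 0} \<inter>
      {c \<in> space (\<Pi>\<^sub>M i\<in>UNIV. borel). Cauchy (\<lambda>N. \<Sum>n<N. (cmod (c n))\<^sup>2 / \<omega> n)}"
    by (auto simp: Xw_def space_PiM summable_iff_convergent Cauchy_convergent_iff)
  also have "\<dots> \<in> sets (\<Pi>\<^sub>M i\<in>UNIV. borel)"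
    by (intro sets.Int sets_Collect_Cauchy) measurable
  finally show ?thesis .
qed

text \<open>The dense set consists of finitely supported sequences with entries in a countable dense
  set of complex numbers, encoded by lists so that countability is immediate.\<close>

lemma Xw_separable:
  obtains D where "countable D" "D \<subseteq> Xw \<omega>"
    "\<And>x e. x \<in> Xw \<omega> \<Longrightarrow> 0 < e \<Longrightarrow> \<exists>d\<in>D. nrm2 \<omega> (\<lambda>n. x n - d n) < e"
proof -
  obtain S :: "complex set" where S: "countable S" "\<And>U. open U \<Longrightarrow> U \<noteq> {} \<Longrightarrow> \<exists>d\<in>S. d \<in> U"
    by (rule countable_dense_setE) blast
  define D where "D = (\<lambda>l n. if 3 \<le> n \<and> n < length l then l ! n else 0 :: complex) ` lists S"
  show thesis
  proof
    show "countable D" unfolding D_def using S by auto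
    show "D \<subseteq> Xw \<omega>"
    proof (clarsimp simp: D_def)
      fix l :: "complex list"
      show "(\<lambda>n. if 3 \<le> n \<and> n < length l then l ! n else 0) \<in> Xw \<omega>"
        by (rule Xw_finite(1)[where N="length l"]) auto
    qed
    fix x :: "nat \<Rightarrow> complex" and e :: real assume x: "x \<in> Xw \<omega>" and e: "0 < e"
    obtain N where N: "nrm2 \<omega> (\<lambda>n. x n - (if n < N then x n else 0)) < e / 4"
      by (rule Xw_truncate[OF x, of "e / 4"]) (use e in auto)
    \<comment> \<open>Dividing by \<open>real N + 1\<close> keeps the total of \<open>N\<close>
      coordinate errors strictly below \<open>e / 4\<close> and covers \<open>N = 0\<close>.\<close>
    define \<epsilon> where "\<epsilon> = e / (4 * (real N + 1))"
    have \<epsilon>: "0 < \<epsilon>" using e by (simp add: \<epsilon>_def)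
    define \<delta> where "\<delta> n = sqrt (\<omega> n * \<epsilon>)" for n
    \<comment> \<open>The choice is made at \<open>Suc n\<close> because the tolerance at index 0
      may fail to be positive.\<close>
    have "\<exists>q. q \<in> S \<and> cmod (x (Suc n) - q) < \<delta> (Suc n)" for n
    proof -
      have "0 < \<delta> (Suc n)" using mult_pos_pos[OF pos \<epsilon>, of "Suc n"] by (simp add: \<delta>_def)
      then have "ball (x (Suc n)) (\<delta> (Suc n)) \<noteq> {}" by simp
      then obtain q where "q \<in> S" "q \<in> ball (x (Suc n)) (\<delta> (Suc n))"
        using S(2)[OF open_ball] by blast
      then show ?thesis by (intro exI[of _ q]) (simp add: dist_norm)
    qed
    then obtain p where p: "\<And>n. p n \<in> S" "\<And>n. cmod (x (Suc n) - p n) < \<delta> (Suc n)"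
      by metis
    define q where "q n = p (n - 1)" for n
    have q: "q n \<in> S" "1 \<le> n \<Longrightarrow> cmod (x n - q n) < \<delta> n" for n
      using p(1) p(2)[of "n - 1"] by (simp_all add: q_def)
    define d where "d n = (if 3 \<le> n \<and> n < N then q n else 0)" for n
    have "d = (\<lambda>n. if 3 \<le> n \<and> n < length (map q [0..<N]) then map q [0..<N] ! n else 0)"
      by (rule ext) (simp add: d_def)
    then have "d \<in> D" unfolding D_def by (rule image_eqI) (use q(1) in auto)
    define y where "y n = (if n < N then x n else 0)" for n
    have y: "y \<in> Xw \<omega>" "d \<in> Xw \<omega>"
      by (rule Xw_finite[where N=N]; simp add: y_def d_def Xw_zero[OF x])+
    have "nrm2 \<omega> (\<lambda>n. y n - d n) = (\<Sum>n<N. (cmod (y n - d n))\<^sup>2 / \<omega> n)"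
      by (rule Xw_finite; simp add: y_def d_def Xw_zero[OF x])
    also have "\<dots> \<le> (\<Sum>n<N. \<epsilon>)"
    proof (rule sum_mono)
      fix n assume "n \<in> {..<N}"
      show "(cmod (y n - d n))\<^sup>2 / \<omega> n \<le> \<epsilon>"
      proof (cases "n < 3")
        case True then show ?thesis using \<epsilon> by (simp add: y_def d_def Xw_zero[OF x])
      next
        case False
        then have "(cmod (y n - d n))\<^sup>2 \<le> (\<delta> n)\<^sup>2"
          using q(2)[of n] \<open>n \<in> _\<close> by (intro power_mono) (auto simp: y_def d_def)
        also have "\<dots> = \<omega> n * \<epsilon>"
          using pos[of n] False \<epsilon> by (simp add: \<delta>_def)
        finally show ?thesis using pos[of n] False by (simp add: pos_divide_le_eq mult.commute)
      qed
    qed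
    also have "\<dots> < e / 4" using e by (simp add: \<epsilon>_def field_simps)
    finally have "nrm2 \<omega> (\<lambda>n. y n - d n) < e / 4" .
    then have "nrm2 \<omega> (\<lambda>n. x n - d n) < e"
      using nrm2_triangle[OF x y] N by (simp add: y_def)
    with \<open>d \<in> D\<close> show "\<exists>d\<in>D. nrm2 \<omega> (\<lambda>n. x n - d n) < e" by blast
  qed
qed

text \<open>By separability an open set is a countable union of balls, and membership in a ball is
  expressed through countably many coordinates.\<close>
lemma openw_measurable:
  assumes "openw \<omega> U"
  shows "U \<in> sets (\<Pi>\<^sub>M i\<in>UNIV. borel)"
proof -
  obtain D where D: "countable D" "D \<subseteq> Xw \<omega>"
    "\<And>x e. x \<in> Xw \<omega> \<Longrightarrow> 0 < e \<Longrightarrow> \<exists>d\<in>D. nrm2 \<omega> (\<lambda>n. x n - d n) < e"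
    using Xw_separable by blast
  define B where "B d r = {y \<in> Xw \<omega>. nrm2 \<omega> (\<lambda>n. y n - d n) < r}" for d and r :: real
  have [measurable]: "B d r \<in> sets (\<Pi>\<^sub>M i\<in>UNIV. borel)" for d r
  proof -
    have "B d r = Xw \<omega> \<inter> {y \<in> space (\<Pi>\<^sub>M i\<in>UNIV. borel). nrm2 \<omega> (\<lambda>n. y n - d n) < r}"
      by (auto simp: B_def space_PiM)
    also have "\<dots> \<in> sets (\<Pi>\<^sub>M i\<in>UNIV. borel)" by measurable
    finally show ?thesis .
  qed
  define I where "I = {(d, r). d \<in> D \<and> r \<in> \<rat> \<and> B d r \<subseteq> U}"
  have "I \<subseteq> D \<times> \<rat>" by (auto simp: I_def)
  then have "countable I" using D(1) countable_rat by (meson countable_SIGMA countable_subset)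
  have "U \<subseteq> (\<Union>(d, r)\<in>I. B d r)"
  proof
    fix x assume "x \<in> U"
    then have x: "x \<in> Xw \<omega>" using assms by (auto simp: openw_def)
    obtain e where e: "0 < e" "\<And>y. y \<in> Xw \<omega> \<Longrightarrow> normw \<omega> (\<lambda>n. y n - x n) < e \<Longrightarrow> y \<in> U"
      using assms \<open>x \<in> U\<close> unfolding openw_def by blast
    \<comment> \<open>The squared distances of \<open>x\<close> and of \<open>y\<close> to
      \<open>d\<close> will both be below \<open>e^2 / 8\<close>, so the two-term bound gives at
      most \<open>e^2 / 2\<close> for that of \<open>y\<close> to \<open>x\<close>.\<close>
    obtain d where d: "d \<in> D" "nrm2 \<omega> (\<lambda>n. x n - d n) < e\<^sup>2 / 8"
      using D(3)[OF x, of "e\<^sup>2 / 8"] e by auto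
    obtain r where r: "r \<in> \<rat>" "nrm2 \<omega> (\<lambda>n. x n - d n) < r" "r < e\<^sup>2 / 8"
      using Rats_dense_in_real[OF d(2)] by blast
    have "B d r \<subseteq> U"
    proof
      fix y assume "y \<in> B d r"
      then have y: "y \<in> Xw \<omega>" "nrm2 \<omega> (\<lambda>n. y n - d n) < r" by (auto simp: B_def)
      have "nrm2 \<omega> (\<lambda>n. y n - x n) \<le> 2 * nrm2 \<omega> (\<lambda>n. y n - d n) + 2 * nrm2 \<omega> (\<lambda>n. d n - x n)"
        using y d D by (intro nrm2_triangle x) auto
      also have "\<dots> < e\<^sup>2" using y(2) r d(2) zero_le_power2[of e] nrm2_commute[of d x] by linarith
      finally show "y \<in> U" using e y(1) by (simp add: nrm2_less_iff)
    qed
    then show "x \<in> (\<Union>(d, r)\<in>I. B d r)" using d r x by (auto simp: I_def B_def)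
  qed
  then have "U = (\<Union>(d, r)\<in>I. B d r)" by (auto simp: I_def)
  also have "\<dots> \<in> sets (\<Pi>\<^sub>M i\<in>UNIV. borel)"
    using \<open>countable I\<close> by (intro sets.countable_UN'') (auto split: prod.splits)
  finally show ?thesis .
qed

lemma space_borelw: "space (borelw \<omega>) = Xw \<omega>"
  unfolding borelw_def by (intro space_measure_of) (auto simp: openw_def)

lemma sets_borelw: "sets (borelw \<omega>) = sigma_sets (Xw \<omega>) {U. openw \<omega> U}"
  unfolding borelw_def by (intro sets_measure_of) (auto simp: openw_def)

lemma borelw_subset: "B \<in> sets (borelw \<omega>) \<Longrightarrow> B \<in> sets (\<Pi>\<^sub>M i\<in>UNIV. borel)"
  unfolding sets_borelw
  by (induction rule: sigma_sets.induct) (auto intro: openw_measurable Xw_measurable)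

text \<open>Norm-open sets are measurable in the product sigma-algebra, so measurability into the
  space may be checked coordinate by coordinate.\<close>

lemma measurable_borelwI:
  assumes "f \<in> M \<rightarrow>\<^sub>M (\<Pi>\<^sub>M i\<in>UNIV. borel)" "\<And>x. x \<in> space M \<Longrightarrow> f x \<in> Xw \<omega>"
  shows "f \<in> M \<rightarrow>\<^sub>M borelw \<omega>"
  unfolding borelw_def
proof (rule measurable_measure_of)
  show "f -` U \<inter> space M \<in> sets M" if "U \<in> {U. openw \<omega> U}" for U
    using that by (intro measurable_sets[OF assms(1)] openw_measurable) auto
qed (use assms(2) in \<open>auto simp: openw_def\<close>)

lemma component_borelw_measurable: "(\<lambda>y. y n) \<in> borel_measurable (borelw \<omega>)"
proof (rule borel_measurableI)
  fix S :: "complex set" assume S: "open S"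
  have "openw \<omega> ((\<lambda>y. y n) -` S \<inter> Xw \<omega>)"
    unfolding openw_def
  proof (intro conjI ballI)
    fix x assume x: "x \<in> (\<lambda>y. y n) -` S \<inter> Xw \<omega>"
    then obtain e where e: "0 < e" "\<And>z. cmod (z - x n) < e \<Longrightarrow> z \<in> S"
      using S unfolding open_dist dist_norm by blast
    show "\<exists>e>0. \<forall>y\<in>Xw \<omega>. normw \<omega> (\<lambda>n. y n - x n) < e \<longrightarrow> y \<in> (\<lambda>y. y n) -` S \<inter> Xw \<omega>"
    proof (cases "n < 3")
      case True
      show ?thesis
      proof (intro exI[of _ "1::real"] conjI ballI impI)
        fix y assume y: "y \<in> Xw \<omega>"
        then have "y n = x n" using Xw_zero[OF y True] Xw_zero[of x \<omega> n] x True by simp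
        with y x show "y \<in> (\<lambda>y. y n) -` S \<inter> Xw \<omega>" by simp
      qed simp
    next
      case False
      then have w: "0 < \<omega> n" using pos[of n] by simp
      show ?thesis
      \<comment> \<open>A change of size \<open>e\<close> in coordinate \<open>n\<close> costs at
        least \<open>e / sqrt (\<omega> n)\<close> in norm.\<close>
      proof (intro exI[of _ "e / sqrt (\<omega> n)"] conjI ballI impI)
        show "0 < e / sqrt (\<omega> n)" using e w by simp
        fix y assume y: "y \<in> Xw \<omega>" "normw \<omega> (\<lambda>n. y n - x n) < e / sqrt (\<omega> n)"
        then have "nrm2 \<omega> (\<lambda>n. y n - x n) < e\<^sup>2 / \<omega> n"
          using e w by (subst (asm) nrm2_less_iff) (auto simp: power_divide)
        then have "(cmod (y n - x n))\<^sup>2 / \<omega> n < e\<^sup>2 / \<omega> n"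
          using term_le_nrm2[OF Xw_diff(1)[OF y(1)], of x n] x by auto
        then have "(cmod (y n - x n))\<^sup>2 < e\<^sup>2" using w by (simp add: divide_less_cancel)
        then have "cmod (y n - x n) < e" using e by (simp add: power2_less_imp_less)
        then show "y \<in> (\<lambda>y. y n) -` S \<inter> Xw \<omega>" using e(2) y(1) by auto
      qed
    qed
  qed auto
  then show "(\<lambda>y. y n) -` S \<inter> space (borelw \<omega>) \<in> sets (borelw \<omega>)"
    unfolding space_borelw sets_borelw by auto
qed

lemma innerw_borelw_measurable: "(\<lambda>y. innerw \<omega> y x) \<in> borel_measurable (borelw \<omega>)"
proof -
  note component_borelw_measurable[measurable]
  show ?thesis unfolding innerw_def by measurable
qed

end

section \<open>Chains of the Collatz operator\<close>

fun twin :: "nat \<Rightarrow> nat" where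
  "twin n = (if n = 0 then 0 else if odd n then 3 * n + 1 else 2 * twin (n div 2))"

declare twin.simps [simp del]

lemma twin_0 [simp]: "twin 0 = 0"
  by (simp add: twin.simps)

lemma twin_odd: "odd n \<Longrightarrow> twin n = 3 * n + 1"
  by (subst twin.simps) (auto elim: oddE)

lemma twin_double [simp]: "twin (2 * n) = 2 * twin n"
  by (cases "n = 0") (simp_all add: twin.simps[of "2 * n"])

lemma twin_power: "twin (k * 2 ^ n) = twin k * 2 ^ n"
proof (induction n)
  case (Suc n)
  have "twin (k * 2 ^ Suc n) = twin (2 * (k * 2 ^ n))" by (simp add: ac_simps)
  then show ?case using Suc by (simp del: mult_Suc)
qed simp

text \<open>\<open>twin n\<close> is \<open>3 * n + 2 ^ v\<close>, with \<open>2 ^ v\<close> the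
  largest power of two dividing \<open>n\<close>. The lower bound makes orbits strictly increasing;
  the upper one keeps images of finitely supported coefficients finitely supported.\<close>

lemma twin_bounds: "1 \<le> n \<Longrightarrow> 3 * n + 1 \<le> twin n \<and> twin n \<le> 4 * n"
proof (induction n rule: less_induct)
  case (less n)
  show ?case
  proof (cases "odd n")
    case True then show ?thesis using less.prems by (simp add: twin_odd)
  next
    case False
    then obtain m where m: "n = 2 * m" by (auto elim: evenE)
    then have "3 * m + 1 \<le> twin m \<and> twin m \<le> 4 * m" using less by auto
    then show ?thesis by (auto simp: m)
  qed
qed

lemma twin_gt: "1 \<le> n \<Longrightarrow> n < twin n"
  using twin_bounds[of n] by simp

lemma twin_ge_4: "1 \<le> n \<Longrightarrow> 4 \<le> twin n"
  using twin_bounds[of n] by simp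

lemma even_twin: "even (twin n)"
proof (cases "odd n")
  case True then show ?thesis by (simp add: twin_odd)
next
  case False then show ?thesis by (auto elim!: evenE)
qed

fun odd_part :: "nat \<Rightarrow> nat" where
  "odd_part n = (if n = 0 then 0 else if odd n then n else odd_part (n div 2))"

declare odd_part.simps [simp del]

lemma odd_part_double [simp]: "odd_part (2 * n) = odd_part n"
  by (cases "n = 0") (simp_all add: odd_part.simps[of "2 * n"])

lemma odd_part_decomp: "1 \<le> n \<Longrightarrow> 1 \<le> odd_part n \<and> (\<exists>v. n = odd_part n * 2 ^ v)"
proof (induction n rule: less_induct)
  case (less n)
  show ?case
  proof (cases "odd n")
    case True then show ?thesis
      using less.prems by (auto simp: odd_part.simps[of n] intro: exI[of _ 0])
  next
    case False
    then obtain m where m: "n = 2 * m" by (auto elim: evenE)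
    then obtain v where v: "1 \<le> odd_part m" "m = odd_part m * 2 ^ v"
      using less.IH[of m] less.prems by auto
    then have "2 * m = odd_part (2 * m) * 2 ^ Suc v" by simp
    then show ?thesis using v(1) unfolding m odd_part_double by blast
  qed
qed

text \<open>Coordinate \<open>i\<close> of the formal series with coefficient \<open>h j\<close> on
  the vector of index \<open>j\<close> from the overview. Because \<open>j < twin j\<close> for
  \<open>j \<ge> 1\<close>, all contributing indices are at most \<open>i\<close>, so the sum is
  finite for arbitrary \<open>h\<close>. Starting at 1 keeps \<open>h 0\<close>, whose index is
  fixed by doubling, out of the series.\<close>

definition chain :: "(nat \<Rightarrow> complex) \<Rightarrow> nat \<Rightarrow> complex" where
  "chain h i = (if 3 \<le> i then h i - (\<Sum>j\<in>{j\<in>{1..i}. twin j = i}. h j) else 0)"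

lemma chain_add: "chain (\<lambda>j. h j + k j) i = chain h i + chain k i"
  by (simp add: chain_def sum.distrib)

lemma chain_scale: "chain (\<lambda>j. t * h j) i = t * chain h i"
  by (simp add: chain_def sum_distrib_left algebra_simps)

lemma chain_zero [simp]: "chain (\<lambda>j. 0) i = 0"
  by (simp add: chain_def)

lemma chain_diff: "chain (\<lambda>j. h j - k j) i = chain h i - chain k i"
  by (simp add: chain_def sum_subtractf)

text \<open>Coordinate \<open>i\<close> of the image collects the coordinates \<open>2 * i\<close>
  and the odd \<open>l\<close> with \<open>3 * l + 1 = 2 * i\<close>. At such an \<open>l\<close>
  the chain is just \<open>h l\<close>, values of \<open>twin\<close> being even, and the same
  \<open>h l\<close> is subtracted at \<open>2 * i\<close>. After this cancellation only doubled
  indices survive.\<close>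

lemma opT_chain: "opT (chain h) = chain (\<lambda>j. h (2 * j))"
proof
  fix i
  show "opT (chain h) i = chain (\<lambda>j. h (2 * j)) i"
  proof (cases "3 \<le> i")
    case False then show ?thesis by (simp add: opT_def chain_def)
  next
    case True
    define Q where "Q = {l. odd l \<and> 3 * l + 1 = 2 * i}"
    have "Q \<subseteq> {..2 * i}" by (auto simp: Q_def)
    then have fin: "finite Q" by (rule finite_subset) simp
    \<comment> \<open>The value \<open>l = 1\<close> would force \<open>i = 2\<close>, so every odd
      preimage of an index from 3 on is itself in range.\<close>
    have Q3: "3 \<le> l" "odd l" if "l \<in> Q" for l
    proof -
      have "3 * l + 1 = 2 * i" "odd l" using that by (auto simp: Q_def)
      moreover from this have "l \<noteq> 1" "l \<noteq> 2" "l \<noteq> 0" using True by auto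
      ultimately show "3 \<le> l" "odd l" by auto
    qed
    have pre: "{l. 3 \<le> l \<and> collatz l = i} = insert (2 * i) Q"
    proof (intro set_eqI iffI)
      fix l assume "l \<in> {l. 3 \<le> l \<and> collatz l = i}"
      then show "l \<in> insert (2 * i) Q"
        by (cases "even l") (auto simp: collatz_def Q_def)
    next
      fix l assume "l \<in> insert (2 * i) Q"
      then show "l \<in> {l. 3 \<le> l \<and> collatz l = i}"
        using True Q3[of l] by (auto simp: collatz_def Q_def)
    qed
    have "chain h l = h l" if "l \<in> Q" for l
    proof -
      have E: "{j\<in>{1..l}. twin j = l} = {}" using Q3[OF that] even_twin by auto
      show ?thesis unfolding chain_def E using Q3[OF that] by simp
    qed
    then have 1: "(\<Sum>l\<in>Q. chain h l) = (\<Sum>l\<in>Q. h l)" by simp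
    let ?D = "(\<lambda>j. 2 * j) ` {j\<in>{1..i}. twin j = i}"
    \<comment> \<open>The predecessors of \<open>2 * i\<close> under \<open>twin\<close> are the
      doubled predecessors of \<open>i\<close>, when even, and the elements of \<open>Q\<close>,
      when odd.\<close>
    have set: "{j\<in>{1..2 * i}. twin j = 2 * i} = ?D \<union> Q"
    proof (intro set_eqI iffI)
      fix j assume j: "j \<in> {j\<in>{1..2 * i}. twin j = 2 * i}"
      show "j \<in> ?D \<union> Q"
      proof (cases "even j")
        case True
        then obtain k where "j = 2 * k" by (auto elim: evenE)
        with j show ?thesis by auto
      next
        case False with j show ?thesis by (auto simp: Q_def twin_odd)
      qed
    next
      fix j assume "j \<in> ?D \<union> Q"
      then show "j \<in> {j\<in>{1..2 * i}. twin j = 2 * i}"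
        using Q3[of j] by (auto simp: Q_def twin_odd)
    qed
    have "(\<Sum>j\<in>{j\<in>{1..2 * i}. twin j = 2 * i}. h j) = (\<Sum>j\<in>?D. h j) + (\<Sum>l\<in>Q. h l)"
      unfolding set using fin by (intro sum.union_disjoint) (auto simp: Q_def)
    also have "(\<Sum>j\<in>?D. h j) = (\<Sum>j\<in>{j\<in>{1..i}. twin j = i}. h (2 * j))"
      by (subst sum.reindex) (auto simp: inj_on_def)
    finally have 2: "chain h (2 * i) =
        h (2 * i) - (\<Sum>j\<in>{j\<in>{1..i}. twin j = i}. h (2 * j)) - (\<Sum>l\<in>Q. h l)"
      using True by (simp add: chain_def)
    have "opT (chain h) i = chain h (2 * i) + (\<Sum>l\<in>Q. chain h l)"
      using True fin unfolding opT_def pre by (subst sum.insert) (auto simp: Q_def)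
    then show ?thesis unfolding 1 2 using True by (simp add: chain_def)
  qed
qed

text \<open>Transposition: pairing a chain with \<open>u\<close> amounts to pairing its coefficients
  with the differences of \<open>u\<close> along \<open>twin\<close>. Cutting at \<open>N\<close>
  leaves a boundary where \<open>twin j\<close> is out of range and only \<open>u j\<close> has been
  summed.\<close>

lemma sum_chain:
  assumes "\<And>n. n < 3 \<Longrightarrow> u n = 0"
  shows "(\<Sum>n<N. chain h n * u n) =
    (\<Sum>j\<in>{1..<N}. (u j - (if twin j < N then u (twin j) else 0)) * h j)"
proof -
  have "chain h n * u n = (if 1 \<le> n then u n * h n else 0) -
      (\<Sum>j\<in>{1..<N}. if twin j = n then u n * h j else 0)" if "n < N" for n
  proof (cases "n < 3")
    case True then show ?thesis using assms[of n] by (simp cong: if_cong)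
  next
    case False
    have "(\<Sum>j\<in>{1..<N}. if twin j = n then u n * h j else 0) =
        (\<Sum>j\<in>{j\<in>{1..<N}. twin j = n}. u n * h j)"
      by (rule sum.inter_filter[symmetric]) simp
    also have "{j\<in>{1..<N}. twin j = n} = {j\<in>{1..n}. twin j = n}"
      using that by (auto dest: twin_gt[of "_ :: nat", simplified] intro: less_imp_le)
    finally show ?thesis using False by (simp add: chain_def algebra_simps sum_distrib_left)
  qed
  then have "(\<Sum>n<N. chain h n * u n) = (\<Sum>n<N. if 1 \<le> n then u n * h n else 0) -
      (\<Sum>n<N. \<Sum>j\<in>{1..<N}. if twin j = n then u n * h j else 0)"
    by (simp add: sum_subtractf)
  also have "(\<Sum>n<N. if 1 \<le> n then u n * h n else 0) = (\<Sum>j\<in>{1..<N}. u j * h j)"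
    by (rule sum.mono_neutral_cong_right) auto
  also have "(\<Sum>n<N. \<Sum>j\<in>{1..<N}. if twin j = n then u n * h j else 0) =
      (\<Sum>j\<in>{1..<N}. \<Sum>n<N. if twin j = n then u n * h j else 0)"
    by (rule sum.swap)
  also have "\<dots> = (\<Sum>j\<in>{1..<N}. if twin j < N then u (twin j) * h j else 0)"
    by (intro sum.cong refl) (auto simp: sum.delta)
  also have "(\<Sum>j\<in>{1..<N}. u j * h j) - \<dots> =
      (\<Sum>j\<in>{1..<N}. (u j - (if twin j < N then u (twin j) else 0)) * h j)"
    unfolding sum_subtractf[symmetric] by (intro sum.cong) (auto simp: algebra_simps)
  finally show ?thesis .
qed

text \<open>Brings a coordinate into the form of a finite linear combination, to which
  \<open>distr_noise_sum\<close> applies.\<close>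

lemma chain_eq_sum:
  assumes "3 \<le> i"
  shows "chain h i = (\<Sum>j\<in>{1..i}. (of_bool (j = i) - of_bool (twin j = i)) * h j)"
proof -
  have "(\<Sum>j\<in>{1..i}. of_bool (j = i) * h j) = h i"
    using assms by (simp add: of_bool_def if_distrib[of "\<lambda>x. x * _"] sum.delta cong: if_cong)
  moreover have "(\<Sum>j\<in>{1..i}. of_bool (twin j = i) * h j) = (\<Sum>j\<in>{1..i}. if twin j = i then h j else 0)"
    by (intro sum.cong) auto
  moreover have "\<dots> = (\<Sum>j\<in>{j\<in>{1..i}. twin j = i}. h j)"
    by (rule sum.inter_filter[symmetric]) simp
  ultimately show ?thesis using assms by (simp add: chain_def left_diff_distrib sum_subtractf)
qed

lemma chain_finite:
  assumes "\<And>j. N \<le> j \<Longrightarrow> h j = 0" "4 * N \<le> n"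
  shows "chain h n = 0"
proof -
  have "h j = 0" if "twin j = n" for j
  proof (cases "N \<le> j")
    case False
    then have "twin j < 4 * N" using twin_bounds[of j] by (cases "j = 0") auto
    with assms(2) that show ?thesis by simp
  qed (use assms in simp)
  then show ?thesis using assms by (simp add: chain_def)
qed

section \<open>Finite combinations of chain vectors\<close>

definition fin_chains :: "(nat \<Rightarrow> complex) set" where
  "fin_chains = {chain h | h. \<exists>N. \<forall>j\<ge>N. h j = 0}"

lemma fin_chains_zero: "(\<lambda>_. 0) \<in> fin_chains"
  unfolding fin_chains_def by (auto intro!: exI[of _ "\<lambda>_. 0"])

lemma fin_chains_add:
  assumes "x \<in> fin_chains" "y \<in> fin_chains"
  shows "(\<lambda>n. x n + y n) \<in> fin_chains"
proof -
  obtain h k N M where "x = chain h" "y = chain k" "\<forall>j\<ge>N. h j = 0" "\<forall>j\<ge>M. k j = 0"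
    using assms by (auto simp: fin_chains_def)
  then show ?thesis unfolding fin_chains_def
    by (auto simp: chain_add fun_eq_iff intro!: exI[of _ "\<lambda>j. h j + k j"] exI[of _ "max N M"])
qed

lemma fin_chains_scale:
  assumes "x \<in> fin_chains"
  shows "(\<lambda>n. t * x n) \<in> fin_chains"
proof -
  obtain h N where "x = chain h" "\<forall>j\<ge>N. h j = 0"
    using assms by (auto simp: fin_chains_def)
  then show ?thesis unfolding fin_chains_def
    by (auto simp: chain_scale fun_eq_iff intro!: exI[of _ "\<lambda>j. t * h j"] exI[of _ N])
qed

lemma fin_chains_sum:
  assumes "\<And>p. p < P \<Longrightarrow> x p \<in> fin_chains"
  shows "(\<lambda>n. \<Sum>p<(P::nat). x p n) \<in> fin_chains"
  using assms by (induction P) (simp_all add: fin_chains_zero fin_chains_add)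

lemma fin_chains_unit:
  assumes "3 \<le> i"
  shows "(\<lambda>n. of_bool (n = i) - of_bool (n = twin i)) \<in> fin_chains"
proof -
  have "chain (\<lambda>j. of_bool (j = i)) n = of_bool (n = i) - of_bool (n = twin i)" for n
  proof -
    have "(\<Sum>j\<in>{j\<in>{1..n}. twin j = n}. of_bool (j = i)) = (of_bool (n = twin i) :: complex)"
      using assms twin_gt[of i] by (auto simp: of_bool_def sum.delta)
    then show ?thesis using assms twin_gt[of i] by (auto simp: chain_def)
  qed
  then show ?thesis unfolding fin_chains_def
    by (auto simp: fun_eq_iff intro!: exI[of _ "\<lambda>j. of_bool (j = i)"] exI[of _ "Suc i"])
qed

lemma twin_iterate_ge: "1 \<le> i \<Longrightarrow> i \<le> (twin ^^ p) i"
proof (induction p)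
  case (Suc p)
  then show ?case using twin_gt[of "(twin ^^ p) i"] by simp
qed simp

lemma twin_iterate_strict_mono: "1 \<le> i \<Longrightarrow> strict_mono (\<lambda>p. (twin ^^ p) i)"
  unfolding strict_mono_Suc_iff using twin_iterate_ge twin_gt
  by (metis funpow.simps(2) o_apply order.trans)

lemma fin_chains_unit_iterate:
  assumes "3 \<le> i"
  shows "(\<lambda>n. of_bool (n = i) - of_bool (n = (twin ^^ p) i)) \<in> fin_chains"
proof (induction p)
  case 0 then show ?case using fin_chains_zero by simp
next
  case (Suc p)
  let ?k = "(twin ^^ p) i"
  have "3 \<le> ?k" using twin_iterate_ge[of i p] assms by simp
  from fin_chains_add[OF Suc fin_chains_unit[OF this]] show ?case by simp
qed

text \<open>The weight depends on \<open>j\<close> through its odd part \<open>k\<close> alone. Here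
  \<open>\<tau> j\<close> is the squared norm of the chain vector of index \<open>j\<close>, and its
  total \<open>S k\<close> along a chain is finite by hypothesis. The squared weight
  \<open>(1 / 2) ^ k / (1 + S k)\<close> bounds the contribution of that chain by
  \<open>(1 / 2) ^ k\<close>, which is summable over \<open>k\<close>.\<close>

lemma chain_weights_exist:
  fixes \<omega> :: "nat \<Rightarrow> real"
  assumes pos: "\<And>n. 1 \<le> n \<Longrightarrow> 0 < \<omega> n"
    and sm: "\<And>k. 3 \<le> k \<Longrightarrow> summable (\<lambda>n. 1 / \<omega> (k * 2 ^ n))"
  obtains b :: "nat \<Rightarrow> real" where "\<And>j. b (2 * j) = b j" "\<And>j. 0 < b j"
    "summable (\<lambda>j. (b j)\<^sup>2 * (if 3 \<le> j then 1 / \<omega> j else 0))"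
    "summable (\<lambda>j. (b j)\<^sup>2 * (if 1 \<le> j then 1 / \<omega> (twin j) else 0))"
proof -
  define \<tau> where "\<tau> j = (if 3 \<le> j then 1 / \<omega> j else 0) + (if 1 \<le> j then 1 / \<omega> (twin j) else 0)" for j
  have \<tau>_nonneg: "0 \<le> \<tau> j" for j
    using pos[of j] pos[of "twin j"] twin_ge_4[of j] by (auto simp: \<tau>_def intro!: add_nonneg_nonneg)
  have \<tau>_0: "\<tau> 0 = 0" by (simp add: \<tau>_def)
  have sm\<tau>: "summable (\<lambda>n. \<tau> (k * 2 ^ n))" if "1 \<le> k" for k
  proof -
    \<comment> \<open>Summability is assumed for starting points from 3 on; dropping two terms
      replaces \<open>k\<close> by \<open>4 * k\<close> and so covers \<open>k = 1\<close> and
      \<open>k = 2\<close>.\<close>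
    have "summable (\<lambda>n. if 3 \<le> k * 2 ^ (n + 2) then 1 / \<omega> (k * 2 ^ (n + 2)) else 0)"
    proof -
      have "k * 2 ^ (n + 2) = (4 * k) * 2 ^ n" "3 \<le> (4 * k) * 2 ^ n" for n
        using that mult_le_mono[of 3 "4 * k" 1 "2 ^ n"] by (auto simp: power_add)
      then show ?thesis using sm[of "4 * k"] that by (simp only: if_True)
    qed
    then have "summable (\<lambda>n. if 3 \<le> k * 2 ^ n then 1 / \<omega> (k * 2 ^ n) else 0)"
      by (rule summable_iff_shift[THEN iffD1])
    moreover have "summable (\<lambda>n. if 1 \<le> k * 2 ^ n then 1 / \<omega> (twin (k * 2 ^ n)) else 0)"
      using sm[of "twin k"] twin_ge_4[OF that] that by (simp add: twin_power)
    ultimately show ?thesis unfolding \<tau>_def by (rule summable_add)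
  qed
  define S where "S k = (\<Sum>n. \<tau> (k * 2 ^ n))" for k
  have S_nonneg: "0 \<le> S k" if "1 \<le> k" for k
    unfolding S_def using sm\<tau>[OF that] \<tau>_nonneg by (intro suminf_nonneg)
  \<comment> \<open>The absolute value gives positivity for all \<open>k\<close> at once; for
    \<open>k \<ge> 1\<close> it equals \<open>S k\<close>.\<close>
  define \<beta> where "\<beta> k = (1 / 2) ^ k / (1 + \<bar>S k\<bar>)" for k
  have \<beta>_pos: "0 < \<beta> k" for k by (auto simp: \<beta>_def intro!: divide_pos_pos)
  have \<beta>_sum: "(\<Sum>n<N. \<beta> k * \<tau> (k * 2 ^ n)) \<le> (1 / 2) ^ k" if "1 \<le> k" for k N
  proof -
    have "(\<Sum>n<N. \<tau> (k * 2 ^ n)) \<le> S k"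
      unfolding S_def using sm\<tau>[OF that] \<tau>_nonneg by (intro sum_le_suminf) auto
    then have "(\<Sum>n<N. \<beta> k * \<tau> (k * 2 ^ n)) \<le> \<beta> k * S k"
      unfolding sum_distrib_left[symmetric] using \<beta>_pos[of k] by (intro mult_left_mono) auto
    also have "\<dots> = (1 / 2) ^ k * (S k / (1 + S k))"
      using S_nonneg[OF that] by (simp add: \<beta>_def)
    also have "\<dots> \<le> (1 / 2) ^ k * 1"
      using S_nonneg[OF that] by (intro mult_left_mono) (auto simp: divide_le_eq)
    finally show ?thesis by simp
  qed
  define b where "b j = sqrt (\<beta> (odd_part j))" for j
  have b2: "(b j)\<^sup>2 = \<beta> (odd_part j)" for j
    using \<beta>_pos[of "odd_part j"] by (simp add: b_def)
  have "\<forall>n. \<exists>v. 1 \<le> n \<longrightarrow> n = odd_part n * 2 ^ v" using odd_part_decomp by blast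
  then obtain v where v: "\<And>n. 1 \<le> n \<Longrightarrow> n = odd_part n * 2 ^ v n" by metis
  have bound: "(\<Sum>j<N. (b j)\<^sup>2 * \<tau> j) \<le> 2" for N
  proof -
    let ?f = "\<lambda>j. (odd_part j, v j)"
    let ?F = "\<lambda>(k, n). \<beta> k * \<tau> (k * 2 ^ n)"
    have "(\<Sum>j<N. (b j)\<^sup>2 * \<tau> j) = (\<Sum>j\<in>{1..<N}. (b j)\<^sup>2 * \<tau> j)"
      by (rule sum.mono_neutral_right) (auto simp: \<tau>_0 not_le)
    also have "\<dots> = (\<Sum>j\<in>{1..<N}. ?F (?f j))"
    proof (rule sum.cong[OF refl])
      fix j assume "j \<in> {1..<N}"
      then have "odd_part j * 2 ^ v j = j" using v[of j] by simp
      then show "(b j)\<^sup>2 * \<tau> j = ?F (?f j)" by (simp add: b2)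
    qed
    also have "\<dots> = (\<Sum>p\<in>?f ` {1..<N}. ?F p)"
    proof (subst sum.reindex)
      show "inj_on ?f {1..<N}"
      proof (rule inj_onI)
        fix i j assume "i \<in> {1..<N}" "j \<in> {1..<N}" "?f i = ?f j"
        then show "i = j" using v[of i] v[of j] by simp
      qed
    qed simp
    \<comment> \<open>Odd part and exponent of an index below \<open>N\<close> are themselves below
      \<open>N\<close>. The further pairs of the rectangle, among them those with even
      \<open>k\<close>, add nonnegative terms.\<close>
    also have "\<dots> \<le> (\<Sum>p\<in>{1..<N} \<times> {..<N}. ?F p)"
    proof (rule sum_mono2)
      show "?f ` {1..<N} \<subseteq> {1..<N} \<times> {..<N}"
      proof
        fix p assume "p \<in> ?f ` {1..<N}"
        then obtain j where j: "j \<in> {1..<N}" "p = ?f j" by blast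
        have dec: "j = odd_part j * 2 ^ v j" "1 \<le> odd_part j"
          using v[of j] odd_part_decomp[of j] j by auto
        have "odd_part j * 1 \<le> odd_part j * 2 ^ v j" by (intro mult_le_mono) auto
        then have 1: "odd_part j \<le> j" using dec by simp
        have "1 * 2 ^ v j \<le> odd_part j * 2 ^ v j" using dec(2) by (intro mult_le_mono) auto
        then have "2 ^ v j \<le> j" using dec(1) by simp
        then have "v j < j" by (rule less_le_trans[OF less_exp])
        then show "p \<in> {1..<N} \<times> {..<N}" using j 1 dec by auto
      qed
      show "0 \<le> ?F p" for p using \<beta>_pos[of "fst p"] \<tau>_nonneg by (auto simp: case_prod_beta)
    qed simp
    also have "\<dots> = (\<Sum>k\<in>{1..<N}. \<Sum>n<N. \<beta> k * \<tau> (k * 2 ^ n))"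
      by (rule sum.cartesian_product[symmetric])
    also have "\<dots> \<le> (\<Sum>k\<in>{1..<N}. (1 / 2) ^ k)"
      by (intro sum_mono \<beta>_sum) simp
    also have "\<dots> \<le> (\<Sum>k. (1 / 2) ^ k :: real)"
      by (intro sum_le_suminf summable_geometric) auto
    also have "\<dots> = 2" by (subst suminf_geometric) auto
    finally show ?thesis .
  qed
  have sb: "summable (\<lambda>j. (b j)\<^sup>2 * \<tau> j)"
    using \<tau>_nonneg by (intro bounded_imp_summable[of _ 2])
      (auto simp only: lessThan_Suc_atMost[symmetric] bound intro!: mult_nonneg_nonneg zero_le_power2)
  show thesis
  proof
    show "b (2 * j) = b j" "0 < b j" for j using \<beta>_pos by (simp_all add: b_def)
    have *: "0 \<le> (if 3 \<le> j then 1 / \<omega> j else 0)" "0 \<le> (if 1 \<le> j then 1 / \<omega> (twin j) else 0)" for j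
      using pos[of j] pos[of "twin j"] twin_ge_4[of j] by auto
    have **: "summable (\<lambda>j. (b j)\<^sup>2 * f j)" if "\<And>j. 0 \<le> f j" "\<And>j. f j \<le> \<tau> j" for f
      by (rule summable_comparison_test'[OF sb, of 0])
        (use that in \<open>simp add: abs_mult mult_left_mono\<close>)
    show "summable (\<lambda>j. (b j)\<^sup>2 * (if 3 \<le> j then 1 / \<omega> j else 0))"
      by (rule **[OF *(1)]) (use *(2) in \<open>simp only: \<tau>_def\<close>, simp)
    show "summable (\<lambda>j. (b j)\<^sup>2 * (if 1 \<le> j then 1 / \<omega> (twin j) else 0))"
      by (rule **[OF *(2)]) (use *(1) in \<open>simp only: \<tau>_def\<close>, simp)
  qed
qed

lemma chain_measurable:
  assumes "\<And>j. 1 \<le> j \<Longrightarrow> (\<lambda>x. f x j) \<in> borel_measurable M"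
  shows "(\<lambda>x. chain (f x) n) \<in> borel_measurable M"
proof (cases "3 \<le> n")
  case True
  then show ?thesis unfolding chain_def using assms
    by (simp add: borel_measurable_diff borel_measurable_sum)
qed (simp add: chain_def)

text \<open>The bound replaces the squared difference of two indicators by their sum, a form that is
  easy to sum over \<open>n\<close>.\<close>

lemma distr_chain:
  assumes "3 \<le> n"
  obtains s where "0 \<le> s" "distr noise borel (\<lambda>g. chain (\<lambda>j. of_real (d j) * g j) n) = cgauss s"
    "s\<^sup>2 \<le> (\<Sum>j\<in>{1..n}. (of_bool (j = n) + of_bool (twin j = n)) * (d j)\<^sup>2)"
proof
  let ?a = "\<lambda>j. (of_bool (j = n) - of_bool (twin j = n)) * complex_of_real (d j)"
  let ?s = "sqrt (\<Sum>j\<in>{1..n}. (cmod (?a j))\<^sup>2)"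
  show "0 \<le> ?s" by (simp add: sum_nonneg)
  show "distr noise borel (\<lambda>g. chain (\<lambda>j. of_real (d j) * g j) n) = cgauss ?s"
    unfolding chain_eq_sum[OF assms] mult.assoc[symmetric] by (rule distr_noise_sum) simp
  have "?s\<^sup>2 = (\<Sum>j\<in>{1..n}. (cmod (?a j))\<^sup>2)" by (simp add: sum_nonneg)
  also have "\<dots> \<le> (\<Sum>j\<in>{1..n}. (of_bool (j = n) + of_bool (twin j = n)) * (d j)\<^sup>2)"
    by (intro sum_mono) (auto simp: norm_mult power_mult_distrib)
  finally show "?s\<^sup>2 \<le> (\<Sum>j\<in>{1..n}. (of_bool (j = n) + of_bool (twin j = n)) * (d j)\<^sup>2)" .
qed

section \<open>The random series\<close>

locale chain_weights = weight +
  fixes b :: "nat \<Rightarrow> real" and c :: real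
  assumes c_pos: "0 < c" and c_le: "1 \<le> n \<Longrightarrow> c \<le> \<omega> n"
    and b_double: "b (2 * j) = b j" and b_pos: "0 < b j"
    and b_summable: "summable (\<lambda>j. (b j)\<^sup>2 * (if 3 \<le> j then 1 / \<omega> j else 0))"
    and b_summable_twin: "summable (\<lambda>j. (b j)\<^sup>2 * (if 1 \<le> j then 1 / \<omega> (twin j) else 0))"
begin

section \<open>Density of the finite combinations\<close>

lemma fin_chains_Xw: "y \<in> fin_chains \<Longrightarrow> y \<in> Xw \<omega>"
proof -
  assume "y \<in> fin_chains"
  then obtain h N where "y = chain h" "\<forall>j\<ge>N. h j = 0" by (auto simp: fin_chains_def)
  then show ?thesis
    using chain_finite[of N h] by (intro Xw_finite(1)[where N="4 * N"]) (auto simp: chain_def)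
qed

text \<open>A unit vector is a finite combination of chain vectors plus the average of the unit vectors
  along its orbit under \<open>twin\<close>. The orbit points are distinct, so the average of \<open>P\<close> of them has
  squared norm at most \<open>1 / (P c)\<close>.\<close>
lemma fin_chains_approx_unit:
  assumes i: "3 \<le> i" and e: "0 < e"
  obtains y where "y \<in> fin_chains" "nrm2 \<omega> (\<lambda>n. of_bool (n = i) - y n) < e"
proof -
  obtain P :: nat where P: "1 / (c * e) < real P"
    using reals_Archimedean2 by blast
  then have P0: "0 < real P" using c_pos e by (meson less_trans divide_pos_pos mult_pos_pos zero_less_one)
  define t where "t p = (twin ^^ p) i" for p
  have mono: "strict_mono t"
    unfolding t_def using twin_iterate_strict_mono[of i] i by simp
  then have inj: "inj_on t {..<P}" by (auto intro: inj_onI dest: strict_mono_eq)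
  have t3: "3 \<le> t p" for p using twin_iterate_ge[of i p] i by (simp add: t_def)
  define z where "z n = complex_of_real (1 / real P) * of_bool (n \<in> t ` {..<P})" for n
  define y where "y n = of_real (1 / real P) * (\<Sum>p<P. (of_bool (n = i) - of_bool (n = t p) :: complex))" for n
  have y: "y \<in> fin_chains"
    unfolding y_def t_def by (intro fin_chains_scale fin_chains_sum fin_chains_unit_iterate i)
  have "of_bool (n = i) - y n = z n" for n
  proof -
    have "(\<Sum>p<P. (of_bool (n = t p) :: complex)) = (\<Sum>q\<in>t ` {..<P}. of_bool (n = q))"
      by (simp only: sum.reindex[OF inj] o_def)
    also have "\<dots> = of_bool (n \<in> t ` {..<P})"
      unfolding of_bool_def by (rule sum.delta') simp
    finally have "(\<Sum>p<P. (of_bool (n = i) - of_bool (n = t p) :: complex)) =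
        of_nat P * of_bool (n = i) - of_bool (n \<in> t ` {..<P})"
      by (simp add: sum_subtractf)
    then show ?thesis using P0 unfolding y_def z_def by (simp add: right_diff_distrib)
  qed
  moreover have "nrm2 \<omega> z < e"
  proof -
    have z0: "z n = 0" if "n < 3" for n
    proof -
      have "n \<noteq> t p" for p using t3[of p] that by simp
      then show ?thesis by (auto simp: z_def)
    qed
    have "nrm2 \<omega> z = (\<Sum>n<t P. (cmod (z n))\<^sup>2 / \<omega> n)"
      using z0 by (intro Xw_finite(2)) (auto simp: z_def strict_mono_less_eq[OF mono])
    also have "\<dots> = (\<Sum>n\<in>t ` {..<P}. (cmod (z n))\<^sup>2 / \<omega> n)"
      by (rule sum.mono_neutral_right) (auto simp: z_def strict_mono_less[OF mono])
    also have "\<dots> \<le> (\<Sum>n\<in>t ` {..<P}. (1 / real P)\<^sup>2 / c)"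
    proof (rule sum_mono)
      fix n assume n: "n \<in> t ` {..<P}"
      then have "c \<le> \<omega> n" using order.trans[OF _ t3, of 1] by (intro c_le) auto
      then have "(1 / real P)\<^sup>2 / \<omega> n \<le> (1 / real P)\<^sup>2 / c"
        using c_pos by (intro divide_left_mono) auto
      then show "(cmod (z n))\<^sup>2 / \<omega> n \<le> (1 / real P)\<^sup>2 / c"
        using n by (simp add: z_def norm_divide)
    qed
    also have "\<dots> = 1 / (real P * c)"
      using P0 by (simp add: card_image[OF inj] power2_eq_square)
    also have "\<dots> < e"
      using P P0 c_pos e by (simp add: field_simps)
    finally show ?thesis .
  qed
  ultimately show thesis using that[OF y] by simp
qed

text \<open>Induction on the support bound: the top coordinate is a multiple of a unit vector, and
  the remainder has smaller support.\<close>

lemma fin_chains_approx_finite: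
  assumes "\<And>n. n < 3 \<Longrightarrow> x n = 0" "\<And>n. N \<le> n \<Longrightarrow> x n = 0" "0 < e"
  shows "\<exists>y\<in>fin_chains. nrm2 \<omega> (\<lambda>n. x n - y n) < e"
  using assms
proof (induction N arbitrary: x e)
  case 0
  then show ?case
    by (intro bexI[OF _ fin_chains_zero]) (simp_all add: nrm2_def)
next
  case (Suc N)
  define x' where "x' = x(N := 0)"
  have "\<exists>y\<in>fin_chains. nrm2 \<omega> (\<lambda>n. x' n - y n) < e / 4"
    using Suc.prems by (intro Suc.IH) (auto simp: x'_def not_less_eq_eq le_less_Suc_eq)
  then obtain y where y: "y \<in> fin_chains" "nrm2 \<omega> (\<lambda>n. x' n - y n) < e / 4" by blast
  have x': "x' \<in> Xw \<omega>"
    using Suc.prems by (intro Xw_finite(1)[where N="Suc N"]) (auto simp: x'_def)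
  obtain z where z: "z \<in> fin_chains" "nrm2 \<omega> (\<lambda>n. x N * of_bool (n = N) - z n) < e / 4"
  proof (cases "N < 3")
    case True
    then show ?thesis
      using Suc.prems by (intro that[OF fin_chains_zero]) (simp_all add: nrm2_def)
  next
    case False
    \<comment> \<open>Scaling by \<open>x N\<close> multiplies the squared error by
      \<open>(cmod (x N))^2\<close>; the added 1 keeps the divisor positive when that coordinate
      vanishes.\<close>
    define r where "r = (cmod (x N))\<^sup>2 + 1"
    have r: "0 < r" "(cmod (x N))\<^sup>2 < r" by (auto simp: r_def add_nonneg_pos)
    obtain w where w: "w \<in> fin_chains" "nrm2 \<omega> (\<lambda>n. of_bool (n = N) - w n) < e / 4 / r"
      by (rule fin_chains_approx_unit[of N "e / 4 / r"]) (use False Suc.prems r in auto)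
    have d: "(\<lambda>n. of_bool (n = N) - w n) \<in> Xw \<omega>"
      using False by (intro Xw_diff fin_chains_Xw w Xw_finite(1)[where N="Suc N"]) auto
    have "nrm2 \<omega> (\<lambda>n. x N * of_bool (n = N) - x N * w n) =
        (cmod (x N))\<^sup>2 * nrm2 \<omega> (\<lambda>n. of_bool (n = N) - w n)"
      using Xw_scale(2)[OF d, of "x N"] by (simp add: right_diff_distrib)
    also have "\<dots> \<le> r * nrm2 \<omega> (\<lambda>n. of_bool (n = N) - w n)"
      using r nrm2_nonneg[OF d] by (intro mult_right_mono) auto
    also have "\<dots> < r * (e / 4 / r)" using w r by (intro mult_strict_left_mono)
    finally show ?thesis using r by (intro that[OF fin_chains_scale[OF w(1), of "x N"]]) simp
  qed
  have "(\<lambda>n. x N * of_bool (n = N)) \<in> Xw \<omega>"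
    using Suc.prems by (intro Xw_finite(1)[where N="Suc N"]) auto
  then have "nrm2 \<omega> (\<lambda>n. (x' n - y n) + (x N * of_bool (n = N) - z n)) < e"
    using Xw_add(2)[OF Xw_diff(1)[OF x' fin_chains_Xw[OF y(1)]] Xw_diff(1)[OF _ fin_chains_Xw[OF z(1)]]]
      y(2) z(2) by fastforce
  moreover have "(x' n - y n) + (x N * of_bool (n = N) - z n) = x n - (y n + z n)" for n
    by (simp add: x'_def)
  ultimately have "nrm2 \<omega> (\<lambda>n. x n - (y n + z n)) < e" by simp
  then show ?case using fin_chains_add[OF y(1) z(1)] by (intro bexI[of _ "\<lambda>n. y n + z n"])
qed

lemma fin_chains_dense:
  assumes x: "x \<in> Xw \<omega>" and e: "0 < e"
  shows "\<exists>y\<in>fin_chains. nrm2 \<omega> (\<lambda>n. x n - y n) < e"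
proof -
  obtain N where N: "nrm2 \<omega> (\<lambda>n. x n - (if n < N then x n else 0)) < e / 4"
    by (rule Xw_truncate[OF x, of "e / 4"]) (use e in auto)
  define x' where "x' n = (if n < N then x n else 0)" for n
  have x': "x' \<in> Xw \<omega>"
    by (rule Xw_finite(1)[where N=N]) (simp_all add: x'_def Xw_zero[OF x])
  have "\<exists>y\<in>fin_chains. nrm2 \<omega> (\<lambda>n. x' n - y n) < e / 4"
    by (rule fin_chains_approx_finite[where N=N]) (use e in \<open>simp_all add: x'_def Xw_zero[OF x]\<close>)
  then obtain y where y: "y \<in> fin_chains" "nrm2 \<omega> (\<lambda>n. x' n - y n) < e / 4" by blast
  have "nrm2 \<omega> (\<lambda>n. x n - y n) < e"
    using nrm2_triangle[OF x x' fin_chains_Xw[OF y(1)]] N y(2) by (simp add: x'_def)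
  then show ?thesis using y(1) by blast
qed

section \<open>Second moments of the random series\<close>

text \<open>The sum of \<open>(d j)^2\<close> times the squared norm of the chain vector of index
  \<open>j\<close>, split by the two coordinates of that vector.\<close>

definition energy :: "(nat \<Rightarrow> real) \<Rightarrow> real" where
  "energy d = (\<Sum>j. (d j)\<^sup>2 * (if 3 \<le> j then 1 / \<omega> j else 0)) +
     (\<Sum>j. (d j)\<^sup>2 * (if 1 \<le> j then 1 / \<omega> (twin j) else 0))"

lemma inverse_weight_nonneg:
  "0 \<le> (if 3 \<le> j then 1 / \<omega> j else 0)" "0 \<le> (if 1 \<le> j then 1 / \<omega> (twin j) else 0)"
  using pos[of j] pos[of "twin j"] twin_ge_4[of j] by auto

text \<open>The variance of coordinate \<open>n\<close> is at most the sum below; summing over \<open>n\<close> counts each \<open>j\<close>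
  once at \<open>n = j\<close> and once at \<open>n = twin j\<close>.\<close>
lemma variance_sum_le:
  assumes sm: "summable (\<lambda>j. (d j)\<^sup>2 * (if 3 \<le> j then 1 / \<omega> j else 0))"
    "summable (\<lambda>j. (d j)\<^sup>2 * (if 1 \<le> j then 1 / \<omega> (twin j) else 0))"
  shows "(\<Sum>n<N. if 3 \<le> n then (\<Sum>j\<in>{1..n}. (of_bool (j = n) + of_bool (twin j = n)) * (d j)\<^sup>2) / \<omega> n else 0)
    \<le> energy d"
proof -
  have "(if 3 \<le> n then (\<Sum>j\<in>{1..n}. (of_bool (j = n) + of_bool (twin j = n)) * (d j)\<^sup>2) / \<omega> n else 0) \<le>
      (d n)\<^sup>2 * (if 3 \<le> n then 1 / \<omega> n else 0) +
      (\<Sum>j\<in>{1..<N}. if twin j = n then (d j)\<^sup>2 / \<omega> (twin j) else 0)" (is "?l n \<le> ?r n") if "n < N" for n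
  proof (cases "3 \<le> n")
    case True
    have "(\<Sum>j\<in>{1..n}. (of_bool (j = n) + of_bool (twin j = n)) * (d j)\<^sup>2) =
        (\<Sum>j\<in>{1..n}. if j = n then (d n)\<^sup>2 else 0) + (\<Sum>j\<in>{1..n}. if twin j = n then (d j)\<^sup>2 else 0)"
      unfolding sum.distrib[symmetric] by (intro sum.cong) auto
    also have "(\<Sum>j\<in>{1..n}. if j = n then (d n)\<^sup>2 else 0) = (d n)\<^sup>2"
      using True by (simp add: sum.delta)
    also have "(\<Sum>j\<in>{1..n}. if twin j = n then (d j)\<^sup>2 else 0) \<le> (\<Sum>j\<in>{1..<N}. if twin j = n then (d j)\<^sup>2 else 0)"
      using that by (intro sum_mono2) auto
    finally have "?l n \<le> ((d n)\<^sup>2 + (\<Sum>j\<in>{1..<N}. if twin j = n then (d j)\<^sup>2 else 0)) / \<omega> n"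
      using True pos[of n] by (simp add: divide_right_mono)
    also have "\<dots> = ?r n"
      using True by (simp add: add_divide_distrib sum_divide_distrib if_distrib[of "\<lambda>x. x / _"] cong: if_cong)
    finally show ?thesis .
  next
    case False
    have "0 \<le> (if twin j = n then (d j)\<^sup>2 / \<omega> (twin j) else 0)" if "1 \<le> j" for j
      using pos[of "twin j"] twin_ge_4[OF that] by auto
    then show ?thesis using False by (auto intro!: sum_nonneg)
  qed
  then have "(\<Sum>n<N. ?l n) \<le> (\<Sum>n<N. ?r n)" by (intro sum_mono) simp
  also have "\<dots> = (\<Sum>n<N. (d n)\<^sup>2 * (if 3 \<le> n then 1 / \<omega> n else 0)) +
      (\<Sum>j\<in>{1..<N}. \<Sum>n<N. if twin j = n then (d j)\<^sup>2 / \<omega> (twin j) else 0)"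
    by (simp only: sum.distrib sum.swap[of _ "{..<N}" "{1..<N}"])
  also have "(\<Sum>j\<in>{1..<N}. \<Sum>n<N. if twin j = n then (d j)\<^sup>2 / \<omega> (twin j) else 0) \<le>
      (\<Sum>j\<in>{1..<N}. (d j)\<^sup>2 * (if 1 \<le> j then 1 / \<omega> (twin j) else 0))"
  proof (rule sum_mono)
    fix j assume "j \<in> {1..<N}"
    then show "(\<Sum>n<N. if twin j = n then (d j)\<^sup>2 / \<omega> (twin j) else 0) \<le>
        (d j)\<^sup>2 * (if 1 \<le> j then 1 / \<omega> (twin j) else 0)"
      using pos[of "twin j"] twin_ge_4[of j] by (auto simp: sum.delta)
  qed
  also have "\<dots> \<le> (\<Sum>j. (d j)\<^sup>2 * (if 1 \<le> j then 1 / \<omega> (twin j) else 0))"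
    using inverse_weight_nonneg by (intro sum_le_suminf sm mult_nonneg_nonneg) auto
  also have "(\<Sum>n<N. (d n)\<^sup>2 * (if 3 \<le> n then 1 / \<omega> n else 0)) \<le>
      (\<Sum>n. (d n)\<^sup>2 * (if 3 \<le> n then 1 / \<omega> n else 0))"
    using inverse_weight_nonneg by (intro sum_le_suminf sm mult_nonneg_nonneg) auto
  finally show ?thesis by (simp add: energy_def)
qed

text \<open>Each coordinate is a complex Gaussian, whose second moment is \<open>K\<close> times its
  squared deviation. The sum is an extended one because membership in the space is still to be
  derived: applied to \<open>b\<close> the bound gives almost sure membership, applied to the tails
  of \<open>b\<close> it gives smallness.\<close>

lemma second_moment:
  obtains K where "0 < K"
    "\<And>d. summable (\<lambda>j. (d j)\<^sup>2 * (if 3 \<le> j then 1 / \<omega> j else 0)) \<Longrightarrow>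
      summable (\<lambda>j. (d j)\<^sup>2 * (if 1 \<le> j then 1 / \<omega> (twin j) else 0)) \<Longrightarrow>
      (\<integral>\<^sup>+g. (\<Sum>n. ennreal ((cmod (chain (\<lambda>j. of_real (d j) * g j) n))\<^sup>2 / \<omega> n)) \<partial>noise) \<le> ennreal (K * energy d)"
proof -
  obtain K where K: "0 < K" "\<And>\<sigma>. 0 \<le> \<sigma> \<Longrightarrow> (\<integral>\<^sup>+z. ennreal ((cmod z)\<^sup>2) \<partial>cgauss \<sigma>) = ennreal (\<sigma>\<^sup>2 * K)"
    using nn_integral_cgauss_square by blast
  show thesis
  proof (rule that[OF K(1)])
    fix d
    assume sm: "summable (\<lambda>j. (d j)\<^sup>2 * (if 3 \<le> j then 1 / \<omega> j else 0))"
      "summable (\<lambda>j. (d j)\<^sup>2 * (if 1 \<le> j then 1 / \<omega> (twin j) else 0))"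
    let ?V = "\<lambda>g n. chain (\<lambda>j. of_real (d j) * g j) n"
    have [measurable]: "(\<lambda>g. ?V g n) \<in> borel_measurable noise" for n
      by (rule chain_measurable) measurable
    let ?q = "\<lambda>n. if 3 \<le> n then (\<Sum>j\<in>{1..n}. (of_bool (j = n) + of_bool (twin j = n)) * (d j)\<^sup>2) / \<omega> n else 0"
    have q_nonneg: "0 \<le> ?q n" for n
      using pos[of n] by (auto intro!: divide_nonneg_pos sum_nonneg)
    have le: "(\<integral>\<^sup>+g. ennreal ((cmod (?V g n))\<^sup>2 / \<omega> n) \<partial>noise) \<le> ennreal (K * ?q n)" for n
    proof (cases "3 \<le> n")
      case False then show ?thesis by (simp add: chain_def)
    next
      case True
      then have w: "0 < \<omega> n" using pos[of n] by simp
      obtain s where s: "0 \<le> s" "distr noise borel (\<lambda>g. ?V g n) = cgauss s"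
        "s\<^sup>2 \<le> (\<Sum>j\<in>{1..n}. (of_bool (j = n) + of_bool (twin j = n)) * (d j)\<^sup>2)"
        using distr_chain[OF True] by blast
      have "(\<integral>\<^sup>+g. ennreal ((cmod (?V g n))\<^sup>2 / \<omega> n) \<partial>noise) =
          (\<integral>\<^sup>+g. ennreal (1 / \<omega> n) * ennreal ((cmod (?V g n))\<^sup>2) \<partial>noise)"
        using w by (simp add: ennreal_mult'[symmetric])
      also have "\<dots> = ennreal (1 / \<omega> n) * (\<integral>\<^sup>+g. ennreal ((cmod (?V g n))\<^sup>2) \<partial>noise)"
        by (rule nn_integral_cmult) measurable
      also have "(\<integral>\<^sup>+g. ennreal ((cmod (?V g n))\<^sup>2) \<partial>noise) =
          (\<integral>\<^sup>+z. ennreal ((cmod z)\<^sup>2) \<partial>distr noise borel (\<lambda>g. ?V g n))"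
        by (subst nn_integral_distr) auto
      also have "\<dots> = ennreal (s\<^sup>2 * K)" using s K by simp
      also have "ennreal (1 / \<omega> n) * ennreal (s\<^sup>2 * K) = ennreal (K * (s\<^sup>2 / \<omega> n))"
        using w K by (simp add: ennreal_mult'[symmetric] ac_simps)
      also have "\<dots> \<le> ennreal (K * ?q n)"
        using s(3) K w True by (intro ennreal_leI mult_left_mono) (auto intro: divide_right_mono)
      finally show ?thesis .
    qed
    have "(\<integral>\<^sup>+g. (\<Sum>n. ennreal ((cmod (?V g n))\<^sup>2 / \<omega> n)) \<partial>noise) =
        (\<Sum>n. \<integral>\<^sup>+g. ennreal ((cmod (?V g n))\<^sup>2 / \<omega> n) \<partial>noise)"
      by (rule nn_integral_suminf) measurable
    also have "\<dots> \<le> ennreal (K * energy d)"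
    proof (rule suminf_le_const[OF summableI])
      fix N
      have "(\<Sum>n<N. \<integral>\<^sup>+g. ennreal ((cmod (?V g n))\<^sup>2 / \<omega> n) \<partial>noise) \<le> (\<Sum>n<N. ennreal (K * ?q n))"
        by (intro sum_mono le)
      also have "\<dots> = ennreal (\<Sum>n<N. K * ?q n)"
        using K q_nonneg by (intro sum_ennreal) auto
      also have "\<dots> \<le> ennreal (K * energy d)"
        unfolding sum_distrib_left[symmetric] using K variance_sum_le[OF sm, of N]
        by (intro ennreal_leI mult_left_mono) auto
      finally show "(\<Sum>n<N. \<integral>\<^sup>+g. ennreal ((cmod (?V g n))\<^sup>2 / \<omega> n) \<partial>noise) \<le> ennreal (K * energy d)" .
    qed
    finally show "(\<integral>\<^sup>+g. (\<Sum>n. ennreal ((cmod (?V g n))\<^sup>2 / \<omega> n)) \<partial>noise) \<le> ennreal (K * energy d)" .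
  qed
qed

lemma Xw_ennrealI:
  assumes z: "\<And>n. n < 3 \<Longrightarrow> y n = 0" and lt: "(\<Sum>n. ennreal ((cmod (y n))\<^sup>2 / \<omega> n)) < ennreal r"
  shows "y \<in> Xw \<omega>" "nrm2 \<omega> y < r"
proof -
  have n: "(\<Sum>n. ennreal ((cmod (y n))\<^sup>2 / \<omega> n)) \<noteq> top" using lt by auto
  then have "summable (\<lambda>n. (cmod (y n))\<^sup>2 / \<omega> n)"
    by (intro summable_suminf_not_top term_nonneg z)
  then show y: "y \<in> Xw \<omega>" using z by (simp add: Xw_def)
  have "ennreal (nrm2 \<omega> y) < ennreal r"
    unfolding nrm2_def using lt term_nonneg[of y] z n by (subst suminf_ennreal[symmetric]) auto
  then show "nrm2 \<omega> y < r" using nrm2_nonneg[OF y] by (simp add: ennreal_less_iff)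
qed

section \<open>The random vector and its law\<close>

definition V :: "(nat \<Rightarrow> complex) \<Rightarrow> nat \<Rightarrow> complex" where
  "V g = chain (\<lambda>j. of_real (b j) * g j)"

text \<open>The hypothesis starts at index 1 because \<open>j \<mapsto> 2 ^ n * j\<close> fixes 0,
  while the zero-one argument must read late entries of \<open>g\<close> only.\<close>

lemma V_measurable:
  assumes "\<And>j. 1 \<le> j \<Longrightarrow> (\<lambda>x. f x j) \<in> borel_measurable M"
  shows "(\<lambda>x. V (f x)) \<in> M \<rightarrow>\<^sub>M (\<Pi>\<^sub>M i\<in>UNIV. borel)"
proof -
  have "(\<lambda>x n. V (f x) n) \<in> M \<rightarrow>\<^sub>M (\<Pi>\<^sub>M i\<in>UNIV. borel)"
    unfolding V_def using assms
    by (intro measurable_abs_UNIV chain_measurable borel_measurable_times) auto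
  then show ?thesis by simp
qed

lemma V_noise_measurable [measurable]: "V \<in> noise \<rightarrow>\<^sub>M (\<Pi>\<^sub>M i\<in>UNIV. borel)"
  using V_measurable[of "\<lambda>g. g" noise] by simp

lemma AE_V_Xw: "AE g in noise. V g \<in> Xw \<omega>"
proof -
  obtain K where K: "0 < K"
    "\<And>d. summable (\<lambda>j. (d j)\<^sup>2 * (if 3 \<le> j then 1 / \<omega> j else 0)) \<Longrightarrow>
      summable (\<lambda>j. (d j)\<^sup>2 * (if 1 \<le> j then 1 / \<omega> (twin j) else 0)) \<Longrightarrow>
      (\<integral>\<^sup>+g. (\<Sum>n. ennreal ((cmod (chain (\<lambda>j. of_real (d j) * g j) n))\<^sup>2 / \<omega> n)) \<partial>noise) \<le> ennreal (K * energy d)"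
    using second_moment by blast
  have [measurable]: "(\<lambda>g. V g n) \<in> borel_measurable noise" for n
    unfolding V_def by (rule chain_measurable) measurable
  have "(\<integral>\<^sup>+g. (\<Sum>n. ennreal ((cmod (V g n))\<^sup>2 / \<omega> n)) \<partial>noise) \<le> ennreal (K * energy b)"
    unfolding V_def by (rule K(2)[OF b_summable b_summable_twin])
  then have "(\<integral>\<^sup>+g. (\<Sum>n. ennreal ((cmod (V g n))\<^sup>2 / \<omega> n)) \<partial>noise) \<noteq> \<infinity>"
    by (metis ennreal_neq_top infinity_ennreal_def top.extremum_unique)
  then have "AE g in noise. (\<Sum>n. ennreal ((cmod (V g n))\<^sup>2 / \<omega> n)) \<noteq> \<infinity>"
    by (intro nn_integral_noteq_infinite) measurable
  then show ?thesis
  proof eventually_elim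
    case (elim g)
    have z: "V g n = 0" if "n < 3" for n using that by (simp add: V_def chain_def)
    have "summable (\<lambda>n. (cmod (V g n))\<^sup>2 / \<omega> n)"
      using elim by (intro summable_suminf_not_top term_nonneg z) auto
    then show ?case using z by (simp add: Xw_def)
  qed
qed

text \<open>A correction of \<open>V\<close> on a null set, so that the image measure lives on the
  space itself; \<open>emeasure_law\<close> returns to \<open>V\<close>.\<close>

definition V' :: "(nat \<Rightarrow> complex) \<Rightarrow> nat \<Rightarrow> complex" where
  "V' g = (if V g \<in> Xw \<omega> then V g else (\<lambda>_. 0))"

lemma AE_V': "AE g in noise. V' g = V g"
  using AE_V_Xw by eventually_elim (simp add: V'_def)

lemma V'_Xw: "V' g \<in> Xw \<omega>"
  by (simp add: V'_def zero_in_Xw)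

lemma V'_measurable [measurable]: "V' \<in> noise \<rightarrow>\<^sub>M borelw \<omega>"
proof (rule measurable_borelwI)
  have "{g \<in> space noise. V g \<in> Xw \<omega>} \<in> sets noise"
    using measurable_sets[OF V_noise_measurable Xw_measurable] by (simp add: vimage_def)
  then show "V' \<in> noise \<rightarrow>\<^sub>M (\<Pi>\<^sub>M i\<in>UNIV. borel)"
    unfolding V'_def by (intro measurable_If) (auto simp: space_PiM)
qed (rule V'_Xw)

definition law :: "(nat \<Rightarrow> complex) measure" where
  "law = distr noise (borelw \<omega>) V'"

lemma space_law [simp]: "space law = Xw \<omega>"
  by (simp add: law_def space_borelw)

lemma sets_law [simp, measurable_cong]: "sets law = sets (borelw \<omega>)"
  by (simp add: law_def)

lemma prob_space_law: "prob_space law"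
  unfolding law_def by (rule noise.prob_space_distr) measurable

lemma emeasure_law:
  assumes "B \<in> sets (borelw \<omega>)"
  shows "emeasure law B = emeasure noise {g. V g \<in> B}"
proof -
  have m: "{g. V g \<in> B} \<in> sets noise" "{g. V' g \<in> B} \<in> sets noise"
    using measurable_sets[OF V_noise_measurable borelw_subset[OF assms]]
      measurable_sets[OF V'_measurable assms] by (simp_all add: vimage_def)
  have "emeasure law B = emeasure noise {g. V' g \<in> B}"
    using assms by (simp add: law_def emeasure_distr vimage_def)
  also have "\<dots> = emeasure noise {g. V g \<in> B}"
    by (rule emeasure_eq_AE[OF _ m(2,1)]) (use AE_V' in eventually_elim, simp)
  finally show ?thesis .
qed

section \<open>Properties of its law\<close>

lemma inner_sum_eq:
  assumes "x \<in> Xw \<omega>"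
  shows "(\<Sum>n<N. V g n * (cnj (x n) / of_real (\<omega> n))) =
    (\<Sum>j\<in>{1..<N}. ((cnj (x j) / of_real (\<omega> j) -
      (if twin j < N then cnj (x (twin j)) / of_real (\<omega> (twin j)) else 0)) * of_real (b j)) * g j)"
proof -
  have "(\<Sum>n<N. V g n * (cnj (x n) / of_real (\<omega> n))) =
      (\<Sum>j\<in>{1..<N}. (cnj (x j) / of_real (\<omega> j) -
      (if twin j < N then cnj (x (twin j)) / of_real (\<omega> (twin j)) else 0)) * (of_real (b j) * g j))"
    unfolding V_def by (rule sum_chain) (simp add: Xw_zero[OF assms])
  then show ?thesis by (simp only: mult.assoc)
qed

text \<open>Every term of the squared norm of \<open>x\<close> is at most
  \<open>nrm2 \<omega> x\<close>, so the squared coefficient at \<open>j\<close> is at most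
  \<open>2 * nrm2 \<omega> x\<close> times the \<open>j\<close>-th contribution to
  \<open>energy b\<close>. The bound is uniform in \<open>N\<close>, as \<open>cgauss_limit\<close>
  requires.\<close>

lemma inner_variance_bound:
  assumes x: "x \<in> Xw \<omega>"
  shows "(\<Sum>j\<in>{1..<N}. (cmod ((cnj (x j) / of_real (\<omega> j) -
      (if twin j < N then cnj (x (twin j)) / of_real (\<omega> (twin j)) else 0)) * of_real (b j)))\<^sup>2)
    \<le> 2 * nrm2 \<omega> x * energy b"
proof -
  let ?u = "\<lambda>n. cnj (x n) / complex_of_real (\<omega> n)"
  let ?r = "\<lambda>j. (b j)\<^sup>2 * (if 3 \<le> j then 1 / \<omega> j else 0)"
  let ?t = "\<lambda>j. (b j)\<^sup>2 * (if 1 \<le> j then 1 / \<omega> (twin j) else 0)"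
  have u: "(cmod (?u n))\<^sup>2 \<le> nrm2 \<omega> x * (if 3 \<le> n then 1 / \<omega> n else 0)" for n
  proof (cases "3 \<le> n")
    case True
    then have w: "0 < \<omega> n" using pos[of n] by simp
    have "(cmod (?u n))\<^sup>2 = (cmod (x n))\<^sup>2 / \<omega> n * (1 / \<omega> n)"
      using w by (simp add: norm_divide power_divide power2_eq_square)
    also have "\<dots> \<le> nrm2 \<omega> x * (1 / \<omega> n)"
      using w by (intro mult_right_mono term_le_nrm2 x) auto
    finally show ?thesis using True by simp
  qed (simp add: Xw_zero[OF x])
  have "(cmod ((?u j - (if twin j < N then ?u (twin j) else 0)) * of_real (b j)))\<^sup>2 \<le>
      2 * nrm2 \<omega> x * (?r j + ?t j)" if "j \<in> {1..<N}" for j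
  proof -
    have t: "3 \<le> twin j" "1 \<le> j" using that twin_ge_4[of j] by auto
    have "(cmod (?u j - (if twin j < N then ?u (twin j) else 0)))\<^sup>2 \<le>
        2 * (cmod (?u j))\<^sup>2 + 2 * (cmod (?u (twin j)))\<^sup>2"
      using cmod_add_square_le[of "?u j" "- ?u (twin j)"] by auto
    also have "\<dots> \<le> 2 * (nrm2 \<omega> x * (if 3 \<le> j then 1 / \<omega> j else 0)) + 2 * (nrm2 \<omega> x * (1 / \<omega> (twin j)))"
      using u[of j] u[of "twin j"] t by (intro add_mono mult_left_mono) auto
    finally have "(cmod (?u j - (if twin j < N then ?u (twin j) else 0)))\<^sup>2 * (b j)\<^sup>2 \<le>
      (2 * (nrm2 \<omega> x * (if 3 \<le> j then 1 / \<omega> j else 0)) + 2 * (nrm2 \<omega> x * (1 / \<omega> (twin j)))) * (b j)\<^sup>2"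
      by (intro mult_right_mono) auto
    also have "\<dots> = 2 * nrm2 \<omega> x * (?r j + ?t j)" using t by (simp add: algebra_simps)
    finally show ?thesis by (simp only: norm_mult norm_of_real power_mult_distrib power2_abs)
  qed
  then have "(\<Sum>j\<in>{1..<N}. (cmod ((?u j - (if twin j < N then ?u (twin j) else 0)) * of_real (b j)))\<^sup>2) \<le>
      (\<Sum>j\<in>{1..<N}. 2 * nrm2 \<omega> x * (?r j + ?t j))"
    by (rule sum_mono)
  also have "\<dots> = 2 * nrm2 \<omega> x * ((\<Sum>j\<in>{1..<N}. ?r j) + (\<Sum>j\<in>{1..<N}. ?t j))"
    by (simp only: sum_distrib_left[symmetric] sum.distrib)
  also have "\<dots> \<le> 2 * nrm2 \<omega> x * energy b"
    unfolding energy_def using nrm2_nonneg[OF x] inverse_weight_nonneg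
    by (intro mult_left_mono add_mono sum_le_suminf b_summable b_summable_twin mult_nonneg_nonneg) auto
  finally show ?thesis .
qed

text \<open>Partial sums of the inner product are finite combinations of the \<open>g j\<close>,
  hence Gaussian. They converge almost surely with bounded deviations, so the limit is Gaussian
  too.\<close>

lemma gaussian_law: "gaussian_measure_Xw \<omega> law"
  unfolding gaussian_measure_Xw_def
proof (intro conjI ballI)
  fix x assume x: "x \<in> Xw \<omega>"
  let ?a = "\<lambda>N j. (cnj (x j) / of_real (\<omega> j) -
      (if twin j < N then cnj (x (twin j)) / of_real (\<omega> (twin j)) else 0)) * complex_of_real (b j)"
  define Z where "Z N g = (\<Sum>n<N. V g n * (cnj (x n) / complex_of_real (\<omega> n)))" for N g
  have [measurable]: "(\<lambda>g. V g n) \<in> borel_measurable noise" for n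
    unfolding V_def by (rule chain_measurable) measurable
  have m: "(\<lambda>g. innerw \<omega> (V' g) x) \<in> borel_measurable noise"
    using measurable_compose[OF V'_measurable innerw_borelw_measurable] .
  obtain s where s: "0 \<le> s" "distr noise borel (\<lambda>g. innerw \<omega> (V' g) x) = cgauss s"
  proof (rule cgauss_limit[where M=noise and Z=Z])
    show "prob_space noise" by (rule noise.prob_space_axioms)
    show "Z N \<in> borel_measurable noise" for N unfolding Z_def by measurable
    show "(\<lambda>g. innerw \<omega> (V' g) x) \<in> borel_measurable noise" by (rule m)
    show "distr noise borel (Z N) = cgauss (sqrt (\<Sum>j\<in>{1..<N}. (cmod (?a N j))\<^sup>2))" for N
      unfolding Z_def inner_sum_eq[OF x] by (rule distr_noise_sum) simp
    show "0 \<le> sqrt (\<Sum>j\<in>{1..<N}. (cmod (?a N j))\<^sup>2)" for N by (simp add: sum_nonneg)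
    show "sqrt (\<Sum>j\<in>{1..<N}. (cmod (?a N j))\<^sup>2) \<le> sqrt (2 * nrm2 \<omega> x * energy b)" for N
      by (intro real_sqrt_le_mono inner_variance_bound x)
    show "AE g in noise. (\<lambda>N. Z N g) \<longlonglongrightarrow> innerw \<omega> (V' g) x"
      using AE_V'
    proof eventually_elim
      case (elim g)
      have "(\<lambda>N. \<Sum>n<N. V' g n * (cnj (x n) / complex_of_real (\<omega> n))) \<longlonglongrightarrow>
          (\<Sum>n. V' g n * (cnj (x n) / complex_of_real (\<omega> n)))"
        by (rule summable_LIMSEQ[OF inner_summable[OF V'_Xw x]])
      then show ?case by (simp add: Z_def innerw_def elim)
    qed
  qed
  have "distr law borel (\<lambda>y. innerw \<omega> y x) = distr noise borel (\<lambda>g. innerw \<omega> (V' g) x)"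
    unfolding law_def using innerw_borelw_measurable by (subst distr_distr) (auto simp: o_def)
  then have "distr law borel (\<lambda>y. innerw \<omega> y x) = cgauss s" using s by simp
  moreover have "(\<lambda>y. innerw \<omega> y x) \<in> borel_measurable law"
    using innerw_borelw_measurable by (simp add: law_def)
  ultimately show "complex_sym_gaussian law (\<lambda>y. innerw \<omega> y x)"
    unfolding complex_sym_gaussian_def cgauss_def using s(1) by blast
qed (auto simp: prob_space_law)

section \<open>Full support\<close>

text \<open>Continuity in finitely many coefficients. The bound \<open>\<delta> * b j\<close> is
  what results when \<open>g j\<close> misses its target by less than \<open>\<delta>\<close>;
  \<open>C n\<close> then bounds coordinate \<open>n\<close> up to the factor
  \<open>\<delta>\<close>.\<close>

lemma chain_head_small:
  assumes "0 < e"
  obtains \<delta> where "0 < \<delta>" "\<And>h. (\<And>j. j < M \<Longrightarrow> cmod (h j) \<le> \<delta> * b j) \<Longrightarrow> (\<And>j. M \<le> j \<Longrightarrow> h j = 0) \<Longrightarrow>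
      chain h \<in> Xw \<omega> \<and> nrm2 \<omega> (chain h) < e"
proof -
  define C where "C n = b n + (\<Sum>j\<in>{j\<in>{1..n}. twin j = n}. b j)" for n
  define S where "S = (\<Sum>n<4 * M. if 3 \<le> n then (C n)\<^sup>2 / \<omega> n else 0)"
  have S: "0 \<le> S"
    unfolding S_def using pos by (intro sum_nonneg) (auto intro!: divide_nonneg_pos)
  define \<delta> where "\<delta> = sqrt (e / (S + 1))"
  have \<delta>: "0 < \<delta>" "\<delta>\<^sup>2 * S < e"
    using assms S by (auto simp: \<delta>_def field_simps intro!: divide_pos_pos)
  show thesis
  proof (rule that[OF \<delta>(1)])
    fix h assume h: "\<And>j. j < M \<Longrightarrow> cmod (h j) \<le> \<delta> * b j" "\<And>j. M \<le> j \<Longrightarrow> h j = 0"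
    have h': "cmod (h j) \<le> \<delta> * b j" for j
      using h(1)[of j] h(2)[of j] \<delta>(1) b_pos[of j] by (cases "j < M") auto
    have fin: "n < 3 \<Longrightarrow> chain h n = 0" "4 * M \<le> n \<Longrightarrow> chain h n = 0" for n
      using chain_finite[of M h n] h(2) by (simp_all add: chain_def)
    have "nrm2 \<omega> (chain h) = (\<Sum>n<4 * M. (cmod (chain h n))\<^sup>2 / \<omega> n)"
      by (rule Xw_finite(2)[OF fin])
    also have "\<dots> \<le> (\<Sum>n<4 * M. \<delta>\<^sup>2 * (if 3 \<le> n then (C n)\<^sup>2 / \<omega> n else 0))"
    proof (rule sum_mono)
      fix n
      show "(cmod (chain h n))\<^sup>2 / \<omega> n \<le> \<delta>\<^sup>2 * (if 3 \<le> n then (C n)\<^sup>2 / \<omega> n else 0)"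
      proof (cases "3 \<le> n")
        case True
        have "cmod (chain h n) \<le> cmod (h n) + cmod (\<Sum>j\<in>{j\<in>{1..n}. twin j = n}. h j)"
          using True by (simp add: chain_def norm_triangle_ineq4)
        also have "\<dots> \<le> \<delta> * b n + (\<Sum>j\<in>{j\<in>{1..n}. twin j = n}. \<delta> * b j)"
          by (intro add_mono h' sum_norm_le)
        also have "\<dots> = \<delta> * C n" by (simp add: C_def distrib_left sum_distrib_left)
        finally have "(cmod (chain h n))\<^sup>2 \<le> (\<delta> * C n)\<^sup>2" by (intro power_mono) auto
        then have "(cmod (chain h n))\<^sup>2 / \<omega> n \<le> (\<delta> * C n)\<^sup>2 / \<omega> n"
          using True pos[of n] by (intro divide_right_mono) auto
        then show ?thesis using True by (simp add: power_mult_distrib)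
      qed (simp add: fin)
    qed
    also have "\<dots> = \<delta>\<^sup>2 * S" by (simp only: S_def sum_distrib_left)
    also have "\<dots> < e" by (rule \<delta>(2))
    finally show "chain h \<in> Xw \<omega> \<and> nrm2 \<omega> (chain h) < e"
      using Xw_finite(1)[OF fin] by simp
  qed
qed

text \<open>An expectation below \<open>e\<close> rules out that the quantity is almost surely at
  least \<open>e\<close>. The energies of the tails tend to 0, so every sufficiently late
  \<open>M\<close> achieves this.\<close>

lemma chain_tail_small:
  assumes e: "0 < e"
  obtains M where "N \<le> M"
    "0 < emeasure noise {g. (\<Sum>n. ennreal ((cmod (chain (\<lambda>j. of_real (if M \<le> j then b j else 0) * g j) n))\<^sup>2 / \<omega> n)) < ennreal e}"
proof -
  obtain K where K: "0 < K"
    "\<And>d. summable (\<lambda>j. (d j)\<^sup>2 * (if 3 \<le> j then 1 / \<omega> j else 0)) \<Longrightarrow>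
      summable (\<lambda>j. (d j)\<^sup>2 * (if 1 \<le> j then 1 / \<omega> (twin j) else 0)) \<Longrightarrow>
      (\<integral>\<^sup>+g. (\<Sum>n. ennreal ((cmod (chain (\<lambda>j. of_real (d j) * g j) n))\<^sup>2 / \<omega> n)) \<partial>noise) \<le> ennreal (K * energy d)"
    using second_moment by blast
  define d where "d M j = (if M \<le> j then b j else 0)" for M j
  have dsq: "(d M j)\<^sup>2 * t = (if M \<le> j then (b j)\<^sup>2 * t else 0)" for M j t by (simp add: d_def)
  have nn: "0 \<le> (b j)\<^sup>2 * (if 3 \<le> j then 1 / \<omega> j else 0)"
    "0 \<le> (b j)\<^sup>2 * (if 1 \<le> j then 1 / \<omega> (twin j) else 0)" for j
    using inverse_weight_nonneg by (intro mult_nonneg_nonneg; simp)+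
  have "(\<lambda>M. K * energy (d M)) \<longlonglongrightarrow> K * (0 + 0)"
    unfolding energy_def dsq
    by (intro tendsto_mult tendsto_const tendsto_add suminf_truncate_tendsto_0 b_summable b_summable_twin nn)
  then have "eventually (\<lambda>M. K * energy (d M) < e) sequentially"
    using e by (intro order_tendstoD(2)) auto
  then obtain M where M: "N \<le> M" "K * energy (d M) < e"
    unfolding eventually_sequentially by (metis nle_le)
  let ?Q = "\<lambda>g. \<Sum>n. ennreal ((cmod (chain (\<lambda>j. of_real (d M j) * g j) n))\<^sup>2 / \<omega> n)"
  have [measurable]: "(\<lambda>g. chain (\<lambda>j. of_real (d M j) * g j) n) \<in> borel_measurable noise" for n
    by (rule chain_measurable) measurable
  have Q: "(\<integral>\<^sup>+g. ?Q g \<partial>noise) \<le> ennreal (K * energy (d M))"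
    by (rule K(2); unfold dsq; rule summable_truncate; intro b_summable b_summable_twin nn)
  have set: "{g. ?Q g < ennreal e} \<in> sets noise"
  proof -
    have "{g \<in> space noise. ?Q g < ennreal e} \<in> sets noise" by measurable
    then show ?thesis by simp
  qed
  have "0 < emeasure noise {g. ?Q g < ennreal e}"
  proof (rule ccontr)
    assume "\<not> ?thesis"
    then have "{g. ?Q g < ennreal e} \<in> null_sets noise" using set by (auto simp: null_sets_def)
    then have "AE g in noise. g \<notin> {g. ?Q g < ennreal e}" by (rule AE_not_in)
    then have "AE g in noise. ennreal e \<le> ?Q g" by eventually_elim (simp add: not_less)
    then have "(\<integral>\<^sup>+g. ennreal e \<partial>noise) \<le> (\<integral>\<^sup>+g. ?Q g \<partial>noise)" by (rule nn_integral_mono_AE)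
    also have "\<dots> \<le> ennreal (K * energy (d M))" by (rule Q)
    also have "\<dots> < ennreal e" using M(2) e by (simp add: ennreal_lessI)
    finally show False using noise.emeasure_space_1 by simp
  qed
  then show thesis using that[OF M(1)] by (simp add: d_def)
qed

text \<open>Choose a finite combination with coefficients \<open>h\<close> near the given point. If
  \<open>g j\<close> is close to \<open>h j / b j\<close> for \<open>j < M\<close> and the series
  over \<open>j \<ge> M\<close> is small, then \<open>V g\<close> is near that combination. Both
  events have positive probability, and they are independent.\<close>

lemma full_support_law: "full_support_Xw \<omega> law"
  unfolding full_support_Xw_def
proof (intro allI impI, elim conjE)
  fix U assume U: "openw \<omega> U" "U \<noteq> {}"
  then obtain x where x: "x \<in> U" "x \<in> Xw \<omega>" by (auto simp: openw_def)
  obtain e where e: "0 < e" "\<And>y. y \<in> Xw \<omega> \<Longrightarrow> normw \<omega> (\<lambda>n. y n - x n) < e \<Longrightarrow> y \<in> U"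
    using U(1) x(1) unfolding openw_def by blast
  \<comment> \<open>Head and tail together put \<open>V g\<close> within
    \<open>4 * \<epsilon>\<close> of \<open>y\<close> in squared norm; passing to \<open>x\<close>
    gives \<open>10 * \<epsilon>\<close>, which is below \<open>e^2\<close>.\<close>
  define \<epsilon> where "\<epsilon> = e\<^sup>2 / 16"
  have \<epsilon>: "0 < \<epsilon>" using e by (simp add: \<epsilon>_def)
  obtain y where y: "y \<in> fin_chains" "nrm2 \<omega> (\<lambda>n. x n - y n) < \<epsilon>"
    using fin_chains_dense[OF x(2) \<epsilon>] by blast
  then obtain h N where h: "y = chain h" "\<And>j. N \<le> j \<Longrightarrow> h j = 0" by (auto simp: fin_chains_def)
  define \<rho> where "\<rho> M g = chain (\<lambda>j. complex_of_real (if M \<le> j then b j else 0) * g j)" for M g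
  obtain M where M: "N \<le> M"
    "0 < emeasure noise {g. (\<Sum>n. ennreal ((cmod (\<rho> M g n))\<^sup>2 / \<omega> n)) < ennreal \<epsilon>}"
    unfolding \<rho>_def using chain_tail_small[OF \<epsilon>, of N] by blast
  obtain \<delta> where \<delta>: "0 < \<delta>" "\<And>k. (\<And>j. j < M \<Longrightarrow> cmod (k j) \<le> \<delta> * b j) \<Longrightarrow> (\<And>j. M \<le> j \<Longrightarrow> k j = 0) \<Longrightarrow>
      chain k \<in> Xw \<omega> \<and> nrm2 \<omega> (chain k) < \<epsilon>"
    using chain_head_small[OF \<epsilon>, of M] by blast
  let ?P = "\<lambda>f. \<forall>j<M. cmod (f j - h j / of_real (b j)) < \<delta>"
  let ?Q = "\<lambda>f. (\<Sum>n. ennreal ((cmod (\<rho> M f n))\<^sup>2 / \<omega> n)) < ennreal \<epsilon>"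
  have P: "?P (restrict g {..<M}) = ?P g" for g :: "nat \<Rightarrow> complex" by auto
  have "\<rho> M (restrict g {M..}) = \<rho> M g" for g
    unfolding \<rho>_def by (rule arg_cong[where f=chain]) auto
  then have Q: "?Q (restrict g {M..}) = ?Q g" for g by simp
  have "0 < emeasure noise {g. ?P (restrict g {..<M}) \<and> ?Q (restrict g {M..})}"
  proof (rule noise_head_tail_pos)
    have [measurable]: "(\<lambda>f. f j) \<in> borel_measurable (\<Pi>\<^sub>M i\<in>{..<M}. borel)" if "j < M" for j
      using that by (intro measurable_component_singleton) auto
    have eq: "{f \<in> space (\<Pi>\<^sub>M i\<in>{..<M}. borel). ?P f} =
        {f \<in> space (\<Pi>\<^sub>M i\<in>{..<M}. borel). \<forall>j\<in>{..<M}. cmod (f j - h j / of_real (b j)) < \<delta>}" by auto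
    show "{f \<in> space (\<Pi>\<^sub>M i\<in>{..<M}. borel). ?P f} \<in> sets (\<Pi>\<^sub>M i\<in>{..<M}. borel)"
      unfolding eq by (intro sets.sets_Collect_finite_All) auto
    have "(\<lambda>f. complex_of_real (if M \<le> j then b j else 0) * f j) \<in> borel_measurable (\<Pi>\<^sub>M i\<in>{M..}. borel)" for j
    proof (cases "M \<le> j")
      case True
      then have [measurable]: "(\<lambda>f. f j) \<in> borel_measurable (\<Pi>\<^sub>M i\<in>{M..}. borel)"
        by (intro measurable_component_singleton) auto
      show ?thesis by measurable
    qed simp
    then have [measurable]: "(\<lambda>f. \<rho> M f n) \<in> borel_measurable (\<Pi>\<^sub>M i\<in>{M..}. borel)" for n
      unfolding \<rho>_def by (intro chain_measurable)
    show "{f \<in> space (\<Pi>\<^sub>M i\<in>{M..}. borel). ?Q f} \<in> sets (\<Pi>\<^sub>M i\<in>{M..}. borel)" by measurable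
    show "0 < emeasure noise {g. ?P (restrict g {..<M})}"
      unfolding P by (rule noise_head_pos[OF \<delta>(1)])
    show "0 < emeasure noise {g. ?Q (restrict g {M..})}"
      unfolding Q by (rule M(2))
  qed
  also have "emeasure noise {g. ?P (restrict g {..<M}) \<and> ?Q (restrict g {M..})} \<le> emeasure noise {g. V g \<in> U}"
  proof (rule emeasure_mono)
    show "{g. ?P (restrict g {..<M}) \<and> ?Q (restrict g {M..})} \<subseteq> {g. V g \<in> U}"
      unfolding P Q
    proof safe
      fix g assume g: "?P g" "?Q g"
      define k where "k j = (if j < M then of_real (b j) * g j - h j else 0)" for j
      have k: "chain k \<in> Xw \<omega> \<and> nrm2 \<omega> (chain k) < \<epsilon>"
      proof (rule \<delta>(2))
        fix j assume "j < M"
        then have "k j = of_real (b j) * (g j - h j / of_real (b j))"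
          using b_pos[of j] by (simp add: k_def right_diff_distrib)
        then have "cmod (k j) = b j * cmod (g j - h j / of_real (b j))"
          using b_pos[of j] by (simp add: norm_mult)
        also have "\<dots> \<le> b j * \<delta>" using g(1) \<open>j < M\<close> b_pos[of j] by (intro mult_left_mono) (auto simp: less_imp_le)
        finally show "cmod (k j) \<le> \<delta> * b j" by (simp add: mult.commute)
      qed (simp add: k_def)
      have \<rho>: "\<rho> M g \<in> Xw \<omega>" "nrm2 \<omega> (\<rho> M g) < \<epsilon>"
        by (rule Xw_ennrealI[OF _ g(2)]; simp add: \<rho>_def chain_def)+
      \<comment> \<open>From \<open>M\<close> on the identity uses that \<open>h\<close> vanishes,
        which is why \<open>N \<le> M\<close> was demanded.\<close>
      have "k j + of_real (if M \<le> j then b j else 0) * g j = of_real (b j) * g j - h j" for j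
        using h(2)[of j] M(1) by (simp add: k_def)
      then have eq: "chain k n + \<rho> M g n = V g n - y n" for n
        unfolding \<rho>_def V_def h(1) chain_add[symmetric] chain_diff[symmetric] by simp
      have Vy: "nrm2 \<omega> (\<lambda>n. V g n - y n) < 4 * \<epsilon>" "(\<lambda>n. V g n - y n) \<in> Xw \<omega>"
        using Xw_add[OF conjunct1[OF k] \<rho>(1)] k \<rho>(2) unfolding eq by auto
      have yX: "y \<in> Xw \<omega>" by (rule fin_chains_Xw[OF y(1)])
      have VX: "V g \<in> Xw \<omega>" using Xw_add(1)[OF Vy(2) yX] by simp
      have "nrm2 \<omega> (\<lambda>n. V g n - x n) \<le> 2 * nrm2 \<omega> (\<lambda>n. V g n - y n) + 2 * nrm2 \<omega> (\<lambda>n. y n - x n)"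
        by (rule nrm2_triangle[OF VX yX x(2)])
      also have "\<dots> < e\<^sup>2" using Vy(1) y(2) \<epsilon> unfolding nrm2_commute[of y x] \<epsilon>_def by linarith
      finally show "V g \<in> U" using e VX by (simp add: nrm2_less_iff)
    qed
    show "{g. V g \<in> U} \<in> sets noise"
      using measurable_sets[OF V_noise_measurable openw_measurable[OF U(1)]] by (simp add: vimage_def)
  qed
  also have "\<dots> = emeasure law U"
    using U(1) by (subst emeasure_law) (auto simp: sets_borelw)
  finally show "0 < emeasure law U" .
qed

section \<open>Invariance and ergodicity\<close>

lemma V_shift: "V (\<lambda>j. g (2 * j)) = opT (V g)"
  unfolding V_def opT_chain b_double ..

lemma V_shift_iterate: "V (\<lambda>j. g (2 ^ n * j)) = (opT ^^ n) (V g)"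
proof (induction n arbitrary: g)
  case (Suc n)
  have "V (\<lambda>j. g (2 ^ Suc n * j)) = V (\<lambda>j. (\<lambda>i. g (2 ^ n * i)) (2 * j))"
    by (simp add: ac_simps)
  also have "\<dots> = opT (V (\<lambda>i. g (2 ^ n * i)))" by (rule V_shift)
  finally show ?case by (simp add: Suc)
qed simp

lemma opT_law_measurable:
  assumes T: "\<And>y. y \<in> Xw \<omega> \<Longrightarrow> opT y \<in> Xw \<omega>"
  shows "opT \<in> law \<rightarrow>\<^sub>M law"
proof -
  note component_borelw_measurable[measurable]
  have "(\<lambda>y. opT y k) \<in> borel_measurable (borelw \<omega>)" for k
    unfolding opT_def by (cases "3 \<le> k") simp_all
  then have "(\<lambda>y k. opT y k) \<in> borelw \<omega> \<rightarrow>\<^sub>M (\<Pi>\<^sub>M i\<in>UNIV. borel)"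
    by (intro measurable_abs_UNIV)
  then have "opT \<in> borelw \<omega> \<rightarrow>\<^sub>M borelw \<omega>"
    using T by (intro measurable_borelwI) (auto simp: space_borelw)
  then show ?thesis by (simp add: law_def)
qed

text \<open>\<open>V\<close> carries the shift of the noise to the operator, and the shift preserves
  the noise. The two preimages agree wherever \<open>V g\<close> lies in the space, that is, almost
  surely.\<close>

lemma T_invariant_law:
  assumes T: "\<And>y. y \<in> Xw \<omega> \<Longrightarrow> opT y \<in> Xw \<omega>"
  shows "T_invariant law"
  unfolding T_invariant_def
proof (intro conjI ballI)
  show m: "opT \<in> law \<rightarrow>\<^sub>M law" by (rule opT_law_measurable[OF T])
  fix B assume "B \<in> sets law"
  then have B: "B \<in> sets (borelw \<omega>)" by simp
  have B': "opT -` B \<inter> space law \<in> sets (borelw \<omega>)"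
    using measurable_sets[OF m \<open>B \<in> sets law\<close>] by simp
  have sV: "{g. V g \<in> S} \<in> sets noise" if "S \<in> sets (borelw \<omega>)" for S
    using measurable_sets[OF V_noise_measurable borelw_subset[OF that]] by (simp add: vimage_def)
  have shift: "(\<lambda>g j. g (2 * j)) \<in> noise \<rightarrow>\<^sub>M noise"
  proof -
    have "(\<lambda>g j. g (2 * j)) \<in> noise \<rightarrow>\<^sub>M (\<Pi>\<^sub>M i\<in>UNIV. borel)"
      by (intro measurable_abs_UNIV) measurable
    then show ?thesis using measurable_cong_sets[OF refl sets_noise] by blast
  qed
  have "emeasure law (opT -` B \<inter> space law) = emeasure noise {g. V g \<in> opT -` B \<inter> space law}"
    by (rule emeasure_law[OF B'])
  also have "\<dots> = emeasure noise {g. V (\<lambda>j. g (2 * j)) \<in> B}"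
  proof (rule emeasure_eq_AE)
    show "AE g in noise. g \<in> {g. V g \<in> opT -` B \<inter> space law} \<longleftrightarrow> g \<in> {g. V (\<lambda>j. g (2 * j)) \<in> B}"
      using AE_V_Xw by eventually_elim (simp add: V_shift)
    show "{g. V g \<in> opT -` B \<inter> space law} \<in> sets noise" by (rule sV[OF B'])
    show "{g. V (\<lambda>j. g (2 * j)) \<in> B} \<in> sets noise"
      using measurable_sets[OF shift sV[OF B]] by (simp add: vimage_def)
  qed
  also have "\<dots> = emeasure (distr noise noise (\<lambda>g j. g (2 * j))) {g. V g \<in> B}"
    using sV[OF B] shift by (simp add: emeasure_distr vimage_def)
  also have "\<dots> = emeasure law B"
    by (simp add: distr_noise_shift emeasure_law[OF B])
  finally show "emeasure law (opT -` B \<inter> space law) = emeasure law B" .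
qed

text \<open>For an invariant set \<open>B\<close> the event \<open>V g \<in> B\<close> agrees almost surely with \<open>V (\<lambda>j. g (2 ^ n * j)) \<in> B\<close>
  for all large \<open>n\<close>. The latter is a tail event because \<open>V\<close> does not read the entry \<open>g 0\<close>.\<close>
lemma T_ergodic_law:
  assumes T: "\<And>y. y \<in> Xw \<omega> \<Longrightarrow> opT y \<in> Xw \<omega>"
  shows "T_ergodic law"
  unfolding T_ergodic_def
proof (intro conjI ballI impI)
  show "T_invariant law" by (rule T_invariant_law[OF T])
  fix B assume "B \<in> sets law" and inv: "opT -` B \<inter> space law = B"
  then have B: "B \<in> sets (borelw \<omega>)" by simp
  define F where "F i = {(\<lambda>g::nat \<Rightarrow> complex. g i) -` A \<inter> space noise | A. A \<in> sets borel}" for i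
  define E where "E = {g. \<exists>N. \<forall>n\<ge>N. V (\<lambda>j. g (2 ^ n * j)) \<in> B}"
  have "(opT ^^ n) y \<in> Xw \<omega> \<and> ((opT ^^ n) y \<in> B \<longleftrightarrow> y \<in> B)" if "y \<in> Xw \<omega>" for y n
  proof (induction n)
    case (Suc n)
    then show ?case using T inv by (auto simp: set_eq_iff)
  qed (simp add: that)
  \<comment> \<open>Invariance of \<open>B\<close> speaks about points of the space, so the two
    events are compared off the null set where \<open>V g\<close> is not in it.\<close>
  then have E_iff: "g \<in> E \<longleftrightarrow> V g \<in> B" if "V g \<in> Xw \<omega>" for g
    using that by (auto simp: E_def V_shift_iterate)
  have tail: "E \<in> noise.tail_events F"
    unfolding noise.tail_events_def
  proof
    fix m
    define S where "S = sigma UNIV (\<Union> (F ` {m..}))"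
    have S: "sets S = sigma_sets (space noise) (\<Union> (F ` {m..}))" "space S = UNIV"
      by (simp_all add: S_def sets_measure_of)
    have comp: "(\<lambda>g. g i) \<in> borel_measurable S" if "m \<le> i" for i
    proof (rule measurableI)
      fix A :: "complex set" assume "A \<in> sets borel"
      then have "(\<lambda>g. g i) -` A \<inter> space S \<in> (\<Union> (F ` {m..}))"
        using that by (auto simp: F_def S)
      then show "(\<lambda>g. g i) -` A \<inter> space S \<in> sets S" unfolding S(1) by blast
    qed simp
    have ev: "{g. V (\<lambda>j. g (2 ^ n * j)) \<in> B} \<in> sets S" if "m \<le> n" for n
    proof -
      \<comment> \<open>The \<open>n\<close>-th event reads entries of index at least
        \<open>2 ^ n\<close>, and \<open>m \<le> n < 2 ^ n\<close>.\<close>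
      have "m \<le> 2 ^ n * j" if "1 \<le> j" for j
      proof -
        have "m \<le> 2 ^ n" by (rule le_trans[OF \<open>m \<le> n\<close> less_imp_le[OF less_exp]])
        also have "\<dots> \<le> 2 ^ n * j" using that by simp
        finally show ?thesis .
      qed
      then have "(\<lambda>g. V (\<lambda>j. g (2 ^ n * j))) \<in> S \<rightarrow>\<^sub>M (\<Pi>\<^sub>M i\<in>UNIV. borel)"
        by (intro V_measurable comp)
      from measurable_sets[OF this borelw_subset[OF B]] show ?thesis by (simp add: vimage_def S(2))
    qed
    \<comment> \<open>The condition gets weaker as \<open>N\<close> grows, so the union may start at
      \<open>m\<close>; then all events in it are measurable for \<open>S\<close>.\<close>
    have "E = (\<Union>N\<in>{m..}. \<Inter>n\<in>{N..}. {g. V (\<lambda>j. g (2 ^ n * j)) \<in> B})"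
    proof (intro set_eqI iffI)
      fix g assume "g \<in> E"
      then obtain N where "\<forall>n\<ge>N. V (\<lambda>j. g (2 ^ n * j)) \<in> B" by (auto simp: E_def)
      then show "g \<in> (\<Union>N\<in>{m..}. \<Inter>n\<in>{N..}. {g. V (\<lambda>j. g (2 ^ n * j)) \<in> B})"
        by (intro UN_I[of "max N m"]) auto
    qed (auto simp: E_def)
    also have "\<dots> \<in> sets S"
      using ev sets.top[of S] S(2) by (intro sets.countable_UN'' sets.countable_INT'') auto
    finally show "E \<in> sigma_sets (space noise) (\<Union> (F ` {m..}))" unfolding S(1) .
  qed
  have F: "noise.indep_sets F UNIV"
    using indep_vars_noise unfolding noise.indep_vars_def2 F_def by simp
  have sa: "sigma_algebra (space noise) (F i)" for i
    using sets.sigma_algebra_axioms[of "vimage_algebra (space noise) (\<lambda>g. g i) (borel :: complex measure)"]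
    by (simp add: F_def sets_vimage_algebra2)
  have "noise.prob E = 0 \<or> noise.prob E = 1"
    by (rule noise.kolmogorov_0_1_law[OF sa F tail])
  moreover have "emeasure law B = emeasure noise E"
  proof -
    have "emeasure noise {g. V g \<in> B} = emeasure noise E"
    proof (rule emeasure_eq_AE)
      show "AE g in noise. g \<in> {g. V g \<in> B} \<longleftrightarrow> g \<in> E"
        using AE_V_Xw by eventually_elim (simp add: E_iff)
      show "{g. V g \<in> B} \<in> sets noise"
        using measurable_sets[OF V_noise_measurable borelw_subset[OF B]] by (simp add: vimage_def)
      show "E \<in> sets noise"
        using noise.tail_events_sets[of F] tail F unfolding noise.indep_sets_def by blast
    qed
    then show ?thesis by (simp add: emeasure_law[OF B])
  qed
  ultimately show "emeasure law B = 0 \<or> emeasure law B = 1"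
    by (auto simp: noise.emeasure_eq_measure)
qed

end

lemma ergodic_gaussian_exists:
  fixes \<omega> :: "nat \<Rightarrow> real"
  assumes pos: "\<And>n. 1 \<le> n \<Longrightarrow> 0 < \<omega> n" and "0 < c" "\<And>n. 1 \<le> n \<Longrightarrow> c \<le> \<omega> n"
    and sm: "\<And>k. 3 \<le> k \<Longrightarrow> summable (\<lambda>n. 1 / \<omega> (k * 2 ^ n))"
    and "bounded_on_Xw \<omega>"
  shows "\<exists>m. gaussian_measure_Xw \<omega> m \<and> full_support_Xw \<omega> m \<and> T_ergodic m"
proof -
  obtain b :: "nat \<Rightarrow> real" where "\<And>j. b (2 * j) = b j" "\<And>j. 0 < b j"
    "summable (\<lambda>j. (b j)\<^sup>2 * (if 3 \<le> j then 1 / \<omega> j else 0))"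
    "summable (\<lambda>j. (b j)\<^sup>2 * (if 1 \<le> j then 1 / \<omega> (twin j) else 0))"
    using chain_weights_exist[OF pos sm] by blast
  then interpret chain_weights \<omega> b c
    using assms by unfold_locales auto
  have "opT y \<in> Xw \<omega>" if "y \<in> Xw \<omega>" for y
    using assms(5) that by (simp add: bounded_on_Xw_def)
  then show ?thesis
    using gaussian_law full_support_law T_ergodic_law by blast
qed

section \<open>The weight omega0\<close>

lemma omega0_pos: "0 < omega0 n"
  by (simp add: omega0_def)

lemma card_collatz_preimage_le: "card {j. 3 \<le> j \<and> collatz j = k} \<le> 2"
  and collatz_preimage_le: "collatz j = k \<Longrightarrow> j \<le> 2 * k"
  and finite_collatz_preimage: "finite {j. 3 \<le> j \<and> collatz j = k}"
proof -
  have dich: "j = 2 * k \<or> 3 * j + 1 = 2 * k" if "collatz j = k" for j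
    using that by (auto simp: collatz_def split: if_splits)
  then have "{j. 3 \<le> j \<and> collatz j = k} \<subseteq> {2 * k, (2 * k - 1) div 3}" by fastforce
  moreover have "card {2 * k, (2 * k - 1) div 3} \<le> 2" by (simp add: card_insert_if)
  ultimately show "card {j. 3 \<le> j \<and> collatz j = k} \<le> 2" "finite {j. 3 \<le> j \<and> collatz j = k}"
    by (meson card_mono finite.emptyI finite.insertI order_trans, meson finite.emptyI finite.insertI finite_subset)
  show "collatz j = k \<Longrightarrow> j \<le> 2 * k" using dich[of j] by auto
qed

text \<open>Cauchy-Schwarz over at most two preimages costs a factor 2, and
  \<open>omega0 j \<le> 2 * omega0 k\<close> for preimages \<open>j\<close> of \<open>k\<close>
  another 2. Preimage sets of distinct points are disjoint, so the squared norm grows by at most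
  4.\<close>

lemma bounded_on_Xw_omega0: "bounded_on_Xw omega0"
proof -
  interpret weight omega0 by unfold_locales (rule omega0_pos)
  have main: "opT y \<in> Xw omega0 \<and> nrm2 omega0 (opT y) \<le> 4 * nrm2 omega0 y" if y: "y \<in> Xw omega0" for y
  proof -
    define A where "A k = {j. 3 \<le> j \<and> collatz j = k}" for k
    have A: "finite (A k)" "card (A k) \<le> 2" for k
      unfolding A_def by (rule finite_collatz_preimage card_collatz_preimage_le)+
    let ?F = "\<lambda>j. 4 * ((cmod (y j))\<^sup>2 / omega0 j)"
    have k: "(cmod (opT y k))\<^sup>2 / omega0 k \<le> (\<Sum>j\<in>A k. ?F j)" if "3 \<le> k" for k
    proof -
      have "(cmod (opT y k))\<^sup>2 \<le> (\<Sum>j\<in>A k. cmod (y j))\<^sup>2"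
        using that by (intro power_mono) (auto simp: opT_def A_def norm_sum)
      also have "\<dots> \<le> (\<Sum>j\<in>A k. (cmod (y j))\<^sup>2) * card (A k)"
        by (rule sum_squared_le_sum_of_squares)
      also have "\<dots> \<le> (\<Sum>j\<in>A k. (cmod (y j))\<^sup>2) * 2"
        using A(2)[of k] by (intro mult_left_mono sum_nonneg) auto
      finally have "(cmod (opT y k))\<^sup>2 / omega0 k \<le> ((\<Sum>j\<in>A k. (cmod (y j))\<^sup>2) * 2) / omega0 k"
        using omega0_pos[of k] by (intro divide_right_mono) auto
      also have "\<dots> = (\<Sum>j\<in>A k. 2 * (cmod (y j))\<^sup>2 / omega0 k)"
        by (simp add: mult.commute[of _ 2] sum_distrib_left sum_divide_distrib)
      also have "\<dots> \<le> (\<Sum>j\<in>A k. ?F j)"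
      proof (rule sum_mono)
        fix j assume "j \<in> A k"
        then have "real j \<le> 2 * real k" using collatz_preimage_le[of j k] by (auto simp: A_def)
        then have "omega0 j \<le> 2 * omega0 k" by (simp add: omega0_def divide_right_mono)
        then have "1 / (2 * omega0 k) \<le> 1 / omega0 j"
          using omega0_pos[of j] by (intro divide_left_mono) (auto intro: mult_pos_pos omega0_pos)
        then have "4 * (cmod (y j))\<^sup>2 * (1 / (2 * omega0 k)) \<le> 4 * (cmod (y j))\<^sup>2 * (1 / omega0 j)"
          by (intro mult_left_mono) auto
        then show "2 * (cmod (y j))\<^sup>2 / omega0 k \<le> ?F j" by simp
      qed
      finally show ?thesis .
    qed
    have "(\<Sum>k<N. (cmod (opT y k))\<^sup>2 / omega0 k) \<le> 4 * nrm2 omega0 y" for N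
    proof -
      have "(\<Sum>k<N. (cmod (opT y k))\<^sup>2 / omega0 k) = (\<Sum>k\<in>{3..<N}. (cmod (opT y k))\<^sup>2 / omega0 k)"
        by (rule sum.mono_neutral_right) (auto simp: opT_def)
      also have "\<dots> \<le> (\<Sum>k\<in>{3..<N}. \<Sum>j\<in>A k. ?F j)" by (intro sum_mono k) simp
      also have "\<dots> = (\<Sum>j\<in>(\<Union>k\<in>{3..<N}. A k). ?F j)"
        using A(1) by (intro sum.UNION_disjoint[symmetric]) (auto simp: A_def)
      also have "\<dots> \<le> (\<Sum>j<2 * N. ?F j)"
      proof (rule sum_mono2)
        show "(\<Union>k\<in>{3..<N}. A k) \<subseteq> {..<2 * N}"
          using collatz_preimage_le by (fastforce simp: A_def)
      qed (use omega0_pos in \<open>auto simp: less_imp_le\<close>)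
      also have "\<dots> \<le> 4 * nrm2 omega0 y"
        unfolding sum_distrib_left[symmetric] using sum_le_nrm2[OF y] by simp
      finally show ?thesis .
    qed
    then show ?thesis using Xw_I[of "opT y" "4 * nrm2 omega0 y"] by (simp add: opT_def)
  qed
  show ?thesis
    unfolding bounded_on_Xw_def
  proof (intro conjI exI[of _ 2] ballI)
    fix y assume "y \<in> Xw omega0"
    then have *: "opT y \<in> Xw omega0" "nrm2 omega0 (opT y) \<le> 4 * nrm2 omega0 y" using main by auto
    show "opT y \<in> Xw omega0" by fact
    have "sqrt (nrm2 omega0 (opT y)) \<le> sqrt (4 * nrm2 omega0 y)" using * by simp
    then show "normw omega0 (opT y) \<le> 2 * normw omega0 y"
      by (simp add: normw_def nrm2_def[symmetric] real_sqrt_mult)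
  qed
qed

theorem theorem3p13:
  shows "(\<forall>\<omega>::nat \<Rightarrow> real.
            (\<forall>n\<ge>1. \<omega> n > 0) \<and>
            (\<exists>c>0. \<forall>n\<ge>1. \<omega> n \<ge> c) \<and>
            (\<forall>k\<ge>3. summable (\<lambda>n. 1 / \<omega> (k * 2 ^ n))) \<and>
            bounded_on_Xw \<omega>
          \<longrightarrow> (\<exists>m. gaussian_measure_Xw \<omega> m \<and> full_support_Xw \<omega> m \<and> T_ergodic m))
       \<and> (\<exists>m. gaussian_measure_Xw omega0 m \<and> full_support_Xw omega0 m \<and> T_ergodic m)"
proof
  show "\<forall>\<omega>::nat \<Rightarrow> real.
            (\<forall>n\<ge>1. \<omega> n > 0) \<and>
            (\<exists>c>0. \<forall>n\<ge>1. \<omega> n \<ge> c) \<and>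
            (\<forall>k\<ge>3. summable (\<lambda>n. 1 / \<omega> (k * 2 ^ n))) \<and>
            bounded_on_Xw \<omega>
          \<longrightarrow> (\<exists>m. gaussian_measure_Xw \<omega> m \<and> full_support_Xw \<omega> m \<and> T_ergodic m)"
    using ergodic_gaussian_exists by blast
  show "\<exists>m. gaussian_measure_Xw omega0 m \<and> full_support_Xw omega0 m \<and> T_ergodic m"
  proof (rule ergodic_gaussian_exists[where c="1 / pi"])
    show "1 / pi \<le> omega0 n" for n by (simp add: omega0_def divide_right_mono)
    fix k :: nat assume "3 \<le> k"
    show "summable (\<lambda>n. 1 / omega0 (k * 2 ^ n))"
    proof (rule summable_comparison_test'[of "\<lambda>n. pi * (1 / 2) ^ n" 0])
      show "summable (\<lambda>n. pi * (1 / 2) ^ n :: real)"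
        by (intro summable_mult summable_geometric) simp
      fix n :: nat
      have "1 * 2 ^ n \<le> real k * 2 ^ n" using \<open>3 \<le> k\<close> by (intro mult_right_mono) auto
      then have "2 ^ n \<le> real k * 2 ^ n + 1" by linarith
      then have "pi / (real k * 2 ^ n + 1) \<le> pi / 2 ^ n"
        by (intro divide_left_mono) (auto intro!: mult_pos_pos add_nonneg_pos)
      then show "norm (1 / omega0 (k * 2 ^ n)) \<le> pi * (1 / 2) ^ n"
        by (simp add: omega0_def power_divide)
    qed
  qed (auto simp: omega0_pos bounded_on_Xw_omega0)
qed

end
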